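(* Let $d\ge 2$ and let $\mathcal{H}_S\cong\mathcal{H}_A\cong\mathbb{C}^d$ be the Hilbert spaces of a system $S$ and an ancilla $A$. Let $\mathcal{E}_{t_1},\mathcal{E}_{t_2}$ be completely positive trace-preserving (CPT) maps on operators on $\mathcal{H}_S$, and let $\rho^{0}_{S+A}$ be an arbitrary density operator on $\mathcal{H}_S\otimes\mathcal{H}_A$. For $j=1,2$ set $$\rho^{(t_j)}_{S+A}=(\mathcal{E}_{t_j}\otimes\mathrm{id}_A)\,\rho^{0}_{S+A},$$ and let $\rho_S(t_1)=\operatorname{tr}_A\rho^{(t_1)}_{S+A}$, $\rho_A(t_1)=\operatorname{tr}_S\rho^{(t_1)}_{S+A}$. Define $$F_\Delta(t_1,t_2)=\min\Big\{\sqrt{2\big(1-\operatorname{tr}\rho_S(t_1)^2\big)},\ \sqrt{2\big(1-\operatorname{tr}\rho_A(t_1)^2\big)}\Big\}-\tilde N\,\max\Big\{\big\|(\rho^{(t_2)}_{S+A})^{T_S}\big\|_1-1,\ \big\|(\rho^{(t_2)}_{S+A})^{T_A}\big\|_1-1\Big\},$$ where $\tilde N=\sqrt{2/(d(d-1))}$, $\|\cdot\|_1$ is the trace norm and $T_S$, $T_A$ denote partial transposition on $S$ resp. $A$, and put $\Delta(t_1,t_2)=\max\{0,-F_\Delta(t_1,t_2)\}$. If $\Delta(t_1,t_2)>0$, then the pair $(\mathcal{E}_{t_1},\mathcal{E}_{t_2})$ is not realizable with classical memory; that is, there do not exist operators $\{K_i\}$ on $\mathcal{H}_S$ and CPT maps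 $\{\Phi_i\}$ on $\mathcal{H}_S$ such that for all operators $\rho$ on $\mathcal{H}_S$ $$\mathcal{E}_{t_1}\rho=\sum_i K_i\rho K_i^\dagger,\qquad \mathcal{E}_{t_2}\rho=\sum_i\Phi_i\big(K_i\rho K_i^\dagger\big).$$
   Context: A pair of CPT maps $(\mathcal{E}_{t_1},\mathcal{E}_{t_2})$ (a "dynamics") on a $d$-dimensional system is called realizable with classical memory if there exist a set of Kraus operators $\{K_i\}$ (with $\sum_i K_i^\dagger K_i=\mathbb{1}$) and CPT maps $\Phi_i$ such that $\mathcal{E}_{t_1}\rho=\sum_i K_i\rho K_i^\dagger$ and $\mathcal{E}_{t_2}\rho=\sum_i\Phi_i(K_i\rho K_i^\dagger)$ for all $\rho$; otherwise it is said to require quantum memory. In the main application $\rho^0_{S+A}$ is the maximally entangled state $|\Psi^+\rangle\langle\Psi^+|$ with $|\Psi^+\rangle=d^{-1/2}\sum_i|i\rangle_S|i\rangle_A$, so that $\rho^{(t_j)}_{S+A}$ is the Choi state of $\mathcal{E}_{t_j}$; the theorem is stated for arbitrary $\rho^0_{S+A}$. *)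

theory Defs
  imports Complex_Main "Jordan_Normal_Form.Matrix"
begin

text \<open>Operators on C^d are d x d complex matrices (type complex mat).
  Operators on H_S (x) H_A = C^d (x) C^d are (d*d) x (d*d) matrices, where the
  product basis vector |i>_S |a>_A has index i*d + a (system factor first).\<close>

definition mtrace :: "complex mat \<Rightarrow> complex" where
  "mtrace A = (\<Sum>i<dim_row A. A $$ (i,i))"

definition adj :: "complex mat \<Rightarrow> complex mat" where
  "adj A = mat (dim_col A) (dim_row A) (\<lambda>(i,j). cnj (A $$ (j,i)))"

definition msum :: "nat \<Rightarrow> 'i set \<Rightarrow> ('i \<Rightarrow> complex mat) \<Rightarrow> complex mat" where
  "msum n I f = mat n n (\<lambda>(r,c). \<Sum>i\<in>I. f i $$ (r,c))"

definition psd :: "nat \<Rightarrow> complex mat \<Rightarrow> bool" where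
  "psd n A \<longleftrightarrow> A \<in> carrier_mat n n \<and>
     (\<forall>v \<in> carrier_vec n.
        let q = (\<Sum>i<n. \<Sum>j<n. cnj (v $ i) * A $$ (i,j) * v $ j)
        in Im q = 0 \<and> Re q \<ge> 0)"

definition density :: "nat \<Rightarrow> complex mat \<Rightarrow> bool" where
  "density n \<rho> \<longleftrightarrow> psd n \<rho> \<and> mtrace \<rho> = 1"

definition ext_id :: "nat \<Rightarrow> nat \<Rightarrow> (complex mat \<Rightarrow> complex mat) \<Rightarrow> complex mat \<Rightarrow> complex mat" where
  "ext_id d n E M = mat (d*n) (d*n) (\<lambda>(r,c).
      E (mat d d (\<lambda>(i,j). M $$ (i*n + r mod n, j*n + c mod n))) $$ (r div n, c div n))"

definition CPT :: "nat \<Rightarrow> (complex mat \<Rightarrow> complex mat) \<Rightarrow> bool" where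
  "CPT d E \<longleftrightarrow>
     (\<forall>A \<in> carrier_mat d d. E A \<in> carrier_mat d d) \<and>
     (\<forall>A \<in> carrier_mat d d. \<forall>B \<in> carrier_mat d d. E (A + B) = E A + E B) \<and>
     (\<forall>A \<in> carrier_mat d d. \<forall>c. E (c \<cdot>\<^sub>m A) = c \<cdot>\<^sub>m E A) \<and>
     (\<forall>n. \<forall>M. psd (d*n) M \<longrightarrow> psd (d*n) (ext_id d n E M)) \<and>
     (\<forall>A \<in> carrier_mat d d. mtrace (E A) = mtrace A)"

definition ptrace_A :: "nat \<Rightarrow> complex mat \<Rightarrow> complex mat" where
  "ptrace_A d \<rho> = mat d d (\<lambda>(i,j). \<Sum>a<d. \<rho> $$ (i*d + a, j*d + a))"

definition ptrace_S :: "nat \<Rightarrow> complex mat \<Rightarrow> complex mat" where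
  "ptrace_S d \<rho> = mat d d (\<lambda>(a,b). \<Sum>i<d. \<rho> $$ (i*d + a, i*d + b))"

definition ptrans_S :: "nat \<Rightarrow> complex mat \<Rightarrow> complex mat" where
  "ptrans_S d \<rho> = mat (d*d) (d*d) (\<lambda>(r,c).
      \<rho> $$ ((c div d)*d + r mod d, (r div d)*d + c mod d))"

definition ptrans_A :: "nat \<Rightarrow> complex mat \<Rightarrow> complex mat" where
  "ptrans_A d \<rho> = mat (d*d) (d*d) (\<lambda>(r,c).
      \<rho> $$ ((r div d)*d + c mod d, (c div d)*d + r mod d))"

text \<open>Trace norm ||A||_1 = tr |A| with |A| = sqrt(A^dagger A) the unique PSD square root.\<close>
definition trace_norm :: "complex mat \<Rightarrow> real" where
  "trace_norm A = Re (mtrace (THE B. psd (dim_col A) B \<and> B * B = adj A * A))"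

definition F_Delta :: "nat \<Rightarrow> (complex mat \<Rightarrow> complex mat) \<Rightarrow> (complex mat \<Rightarrow> complex mat)
    \<Rightarrow> complex mat \<Rightarrow> real" where
  "F_Delta d E1 E2 \<rho>0 =
     (let \<rho>1 = ext_id d d E1 \<rho>0; \<rho>2 = ext_id d d E2 \<rho>0;
          \<rho>S = ptrace_A d \<rho>1; \<rho>A = ptrace_S d \<rho>1;
          Nt = sqrt (2 / (real d * (real d - 1)))
      in min (sqrt (2 * (1 - Re (mtrace (\<rho>S * \<rho>S)))))
             (sqrt (2 * (1 - Re (mtrace (\<rho>A * \<rho>A)))))
         - Nt * max (trace_norm (ptrans_S d \<rho>2) - 1) (trace_norm (ptrans_A d \<rho>2) - 1))"

definition Delta :: "nat \<Rightarrow> (complex mat \<Rightarrow> complex mat) \<Rightarrow> (complex mat \<Rightarrow> complex mat)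
    \<Rightarrow> complex mat \<Rightarrow> real" where
  "Delta d E1 E2 \<rho>0 = max 0 (- F_Delta d E1 E2 \<rho>0)"

definition realizable_classical :: "nat \<Rightarrow> (complex mat \<Rightarrow> complex mat) \<Rightarrow> (complex mat \<Rightarrow> complex mat) \<Rightarrow> bool" where
  "realizable_classical d E1 E2 \<longleftrightarrow>
     (\<exists>(I :: nat set) K \<Phi>. finite I \<and>
        (\<forall>i\<in>I. K i \<in> carrier_mat d d \<and> CPT d (\<Phi> i)) \<and>
        msum d I (\<lambda>i. adj (K i) * K i) = 1\<^sub>m d \<and>
        (\<forall>\<rho> \<in> carrier_mat d d.
           E1 \<rho> = msum d I (\<lambda>i. K i * \<rho> * adj (K i)) \<and>
           E2 \<rho> = msum d I (\<lambda>i. \<Phi> i (K i * \<rho> * adj (K i)))))"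

end

theory Submission
  imports Defs "Jordan_Normal_Form.Schur_Decomposition" "HOL-Analysis.L2_Norm"
begin

text \<open>
  Write \<open>\<rho>0\<close> as a sum of unnormalised pure states. With classical memory, applying the Kraus
  operators \<open>K\<^sub>i\<close> gives a pure-state decomposition of \<open>\<rho>1\<close> into vectors, identified with
  \<open>d \<times> d\<close> matrices \<open>M\<close>, and \<open>\<rho>2\<close> arises by applying a channel on \<open>S\<close> to each
  component. Such channels commute with \<open>T\<^sub>A\<close> and do not increase the trace norm of Hermitian
  operators, so \<open>\<parallel>\<rho>2\<^sup>T\<parallel>\<^sub>1\<close> is at most the sum of the trace norms of the partially transposed
  components.

  The partial transpose \<open>A\<close> of the pure state of \<open>M\<close> satisfies
  \<open>A\<^sup>2 = M M\<^sup>\<dagger> \<otimes> M\<^sup>\<dagger> M\<close>, hence its trace norm is \<open>tr |M\<^sup>\<dagger>| tr |M|\<close>. Cauchy-Schwarz over the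
  \<open>d (d - 1)\<close> off-diagonal pairs of eigenvalues bounds this by
  \<open>tr G + sqrt (d (d - 1)) sqrt ((tr G)\<^sup>2 - tr G\<^sup>2)\<close> with \<open>G = M M\<^sup>\<dagger>\<close>. Finally,
  \<open>G \<mapsto> sqrt ((tr G)\<^sup>2 - tr G\<^sup>2)\<close> is superadditive on positive semidefinite matrices (reverse
  Cauchy-Schwarz), so the sum over the components is controlled by the reduced state of \<open>\<rho>1\<close>.
\<close>

section \<open>Entries, adjoints and traces of matrix products\<close>

lemma mult_mat_entry:
  assumes "A \<in> carrier_mat n m" "B \<in> carrier_mat m k" "i < n" "j < k"
  shows "(A * B) $$ (i,j) = (\<Sum>l<m. A $$ (i,l) * B $$ (l,j))"
  using assms by (auto simp: scalar_prod_def lessThan_atLeast0)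

lemma square_carrier_closed [simp]:
  assumes "A \<in> carrier_mat n n" "B \<in> carrier_mat n n"
  shows "A * B \<in> carrier_mat n n" "A - B \<in> carrier_mat n n" "A + B \<in> carrier_mat n n"
  using assms by auto

lemma adj_carrier [simp]: "A \<in> carrier_mat n m \<Longrightarrow> adj A \<in> carrier_mat m n"
  by (auto simp: adj_def)

lemma adj_entry [simp]: "i < dim_col A \<Longrightarrow> j < dim_row A \<Longrightarrow> adj A $$ (i,j) = cnj (A $$ (j,i))"
  by (simp add: adj_def)

lemma adj_adj [simp]: "adj (adj A) = A"
  by (rule eq_matI) (auto simp: adj_def)

lemma adj_mult:
  assumes "A \<in> carrier_mat n m" "B \<in> carrier_mat m k"
  shows "adj (A * B) = adj B * adj A"
proof (rule eq_matI)
  fix i j assume "i < dim_row (adj B * adj A)" "j < dim_col (adj B * adj A)"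
  then have ij: "i < k" "j < n" using assms by (auto simp: adj_def)
  have "adj (A * B) $$ (i,j) = cnj ((A * B) $$ (j,i))"
    using assms ij by simp
  also have "\<dots> = (\<Sum>l<m. adj B $$ (i,l) * adj A $$ (l,j))"
    unfolding mult_mat_entry[OF assms ij(2,1)] cnj_sum using assms ij
    by (intro sum.cong) auto
  also have "\<dots> = (adj B * adj A) $$ (i,j)"
    using assms ij by (subst mult_mat_entry[of _ k m _ n]) auto
  finally show "adj (A * B) $$ (i,j) = (adj B * adj A) $$ (i,j)" .
qed (use assms in \<open>auto simp: adj_def\<close>)

lemma adj_minus:
  assumes "A \<in> carrier_mat n m" "B \<in> carrier_mat n m"
  shows "adj (A - B) = adj A - adj B"
  using assms by (intro eq_matI) (auto simp: adj_def)

lemma mtrace_sum: "A \<in> carrier_mat n n \<Longrightarrow> mtrace A = (\<Sum>i<n. A $$ (i,i))"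
  by (auto simp: mtrace_def)

lemma mtrace_mult:
  assumes "A \<in> carrier_mat n m" "B \<in> carrier_mat m n"
  shows "mtrace (A * B) = (\<Sum>i<n. \<Sum>j<m. A $$ (i,j) * B $$ (j,i))"
  using assms by (subst mtrace_sum[of _ n]) (auto simp: mult_mat_entry simp del: index_mult_mat(1))

lemma mtrace_mult_commute:
  assumes "A \<in> carrier_mat n m" "B \<in> carrier_mat m n"
  shows "mtrace (A * B) = mtrace (B * A)"
  unfolding mtrace_mult[OF assms] mtrace_mult[OF assms(2,1)]
  by (subst sum.swap) (simp add: mult.commute)

lemma mtrace_add:
  "A \<in> carrier_mat n n \<Longrightarrow> B \<in> carrier_mat n n \<Longrightarrow> mtrace (A + B) = mtrace A + mtrace B"
  by (auto simp: mtrace_def sum.distrib)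

lemma mtrace_minus:
  "A \<in> carrier_mat n n \<Longrightarrow> B \<in> carrier_mat n n \<Longrightarrow> mtrace (A - B) = mtrace A - mtrace B"
  by (auto simp: mtrace_def sum_subtractf)

subsection \<open>Positive semidefinite matrices\<close>

text \<open>The order on complex numbers compares real parts and demands equal imaginary parts, so a
  single \<open>0 \<le>\<close> carries both conditions on the form. Vectors become functions, of
  which only the first \<open>n\<close> values enter.\<close>

lemma psd_iff:
  "psd n A \<longleftrightarrow> A \<in> carrier_mat n n \<and>
    (\<forall>v. 0 \<le> (\<Sum>i<n. \<Sum>j<n. cnj (v i) * A $$ (i,j) * v j))"
proof -
  have *: "(let q = z in Im q = 0 \<and> Re q \<ge> 0) \<longleftrightarrow> 0 \<le> z" for z
    by (auto simp: less_eq_complex_def)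
  have "0 \<le> (\<Sum>i<n. \<Sum>j<n. cnj (v i) * A $$ (i,j) * v j)"
    if "\<forall>v\<in>carrier_vec n. 0 \<le> (\<Sum>i<n. \<Sum>j<n. cnj (v $ i) * A $$ (i,j) * v $ j)" for v
    using bspec[OF that, of "vec n v"] by simp
  then show ?thesis unfolding psd_def * by auto
qed

lemma psd_form: "psd n A \<Longrightarrow> 0 \<le> (\<Sum>i<n. \<Sum>j<n. cnj (v i) * A $$ (i,j) * v j)"
  unfolding psd_iff by simp

lemma psd_carrier: "psd n A \<Longrightarrow> A \<in> carrier_mat n n"
  by (simp add: psd_def)

text \<open>Evaluates the form at e_i + c e_j. Taking \<open>c\<close> to be 0, 1, the imaginary
  unit and \<open>- cnj (A $$ (i,j))\<close> later yields nonnegative diagonals, hermiticity, and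
  the vanishing of matrices with zero diagonal.\<close>

lemma psd_two_entry_form:
  assumes "psd n A" "i < n" "j < n"
  shows "0 \<le> A $$ (i,i) + c * A $$ (i,j) + cnj c * A $$ (j,i) + cnj c * c * A $$ (j,j)"
proof -
  let ?v = "\<lambda>k. (if k = i then 1 else 0) + (if k = j then c else 0)"
  have "0 \<le> (\<Sum>k<n. \<Sum>l<n. cnj (?v k) * A $$ (k,l) * ?v l)"
    using assms(1) by (rule psd_form)
  also have "(\<Sum>k<n. \<Sum>l<n. cnj (?v k) * A $$ (k,l) * ?v l)
      = (\<Sum>k<n. cnj (?v k) * (A $$ (k,i) + A $$ (k,j) * c))"
  proof (intro sum.cong refl)
    fix k
    have "(\<Sum>l<n. A $$ (k,l) * ?v l)
        = (\<Sum>l<n. (if l = i then A $$ (k,l) else 0)) + (\<Sum>l<n. (if l = j then A $$ (k,l) * c else 0))"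
      unfolding sum.distrib[symmetric] by (intro sum.cong) (auto simp: algebra_simps)
    also have "\<dots> = A $$ (k,i) + A $$ (k,j) * c" using assms by simp
    finally show "(\<Sum>l<n. cnj (?v k) * A $$ (k,l) * ?v l) = cnj (?v k) * (A $$ (k,i) + A $$ (k,j) * c)"
      by (simp only: sum_distrib_left[symmetric] mult.assoc)
  qed
  also have "\<dots> = (\<Sum>k<n. if k = i then A $$ (k,i) + A $$ (k,j) * c else 0)
      + (\<Sum>k<n. if k = j then cnj c * (A $$ (k,i) + A $$ (k,j) * c) else 0)"
    unfolding sum.distrib[symmetric] by (intro sum.cong) (auto simp: algebra_simps)
  also have "\<dots> = A $$ (i,i) + c * A $$ (i,j) + cnj c * A $$ (j,i) + cnj c * c * A $$ (j,j)"
    using assms by (simp add: algebra_simps)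
  finally show ?thesis .
qed

lemma psd_diag_nonneg: "psd n A \<Longrightarrow> i < n \<Longrightarrow> 0 \<le> A $$ (i,i)"
  using psd_two_entry_form[of n A i i 0] by simp

lemma psd_hermitian:
  assumes "psd n A" shows "adj A = A"
proof (rule eq_matI)
  fix i j assume "i < dim_row A" "j < dim_col A"
  then have ij: "i < n" "j < n" using psd_carrier[OF assms] by auto
  have "Im (A $$ (i,i)) = 0" "Im (A $$ (j,j)) = 0"
    using psd_diag_nonneg[OF assms] ij by (auto simp: less_eq_complex_def)
  with psd_two_entry_form[OF assms ij, of 1] psd_two_entry_form[OF assms ij, of \<i>]
  have "Im (A $$ (i,j)) = - Im (A $$ (j,i))" "Re (A $$ (i,j)) = Re (A $$ (j,i))"
    by (auto simp: less_eq_complex_def)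
  then show "adj A $$ (i,j) = A $$ (i,j)"
    using ij psd_carrier[OF assms] by (auto simp: complex_eq_iff)
qed (use psd_carrier[OF assms] in \<open>auto simp: adj_def\<close>)

lemma psd_zero_diag_imp_zero:
  assumes "psd n A" "\<And>i. i < n \<Longrightarrow> A $$ (i,i) = 0"
  shows "A = 0\<^sub>m n n"
proof (rule eq_matI)
  fix i j assume "i < dim_row (0\<^sub>m n n :: complex mat)" "j < dim_col (0\<^sub>m n n :: complex mat)"
  then have ij: "i < n" "j < n" by auto
  have h: "A $$ (j,i) = cnj (A $$ (i,j))"
    using psd_hermitian[OF assms(1)] psd_carrier[OF assms(1)] ij
    by (metis adj_entry carrier_matD)
  \<comment> \<open>With both diagonal entries zero, this choice of \<open>c\<close> leaves only the
    two cross terms, each equal to minus the squared modulus.\<close>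
  have "0 \<le> - (2 * (cmod (A $$ (i,j)))\<^sup>2)"
    using psd_two_entry_form[OF assms(1) ij, of "- cnj (A $$ (i,j))"] assms(2) ij
    by (simp add: h less_eq_complex_def cmod_def power2_eq_square)
  then show "A $$ (i,j) = 0\<^sub>m n n $$ (i,j)" using ij by simp
qed (use psd_carrier[OF assms(1)] in auto)

lemma psd_trace_nonneg: "psd n A \<Longrightarrow> 0 \<le> mtrace A"
  by (subst mtrace_sum[OF psd_carrier]) (auto intro!: sum_nonneg psd_diag_nonneg)

lemma psd_trace_zero:
  assumes "psd n A" "mtrace A = 0" shows "A = 0\<^sub>m n n"
proof (rule psd_zero_diag_imp_zero[OF assms(1)])
  fix i assume "i < n"
  moreover have "(\<Sum>i<n. A $$ (i,i)) = 0"
    using assms mtrace_sum[OF psd_carrier[OF assms(1)]] by simp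
  then have "\<forall>i\<in>{..<n}. A $$ (i,i) = 0"
    by (subst (asm) sum_nonneg_eq_0_iff) (use assms in \<open>auto intro: psd_diag_nonneg\<close>)
  ultimately show "A $$ (i,i) = 0" by simp
qed

lemma psd_add:
  assumes "psd n A" "psd n B" shows "psd n (A + B)"
  unfolding psd_iff
proof (intro conjI allI)
  have c: "A \<in> carrier_mat n n" "B \<in> carrier_mat n n" using assms psd_carrier by auto
  then show "A + B \<in> carrier_mat n n" by simp
  fix v
  have "0 \<le> (\<Sum>i<n. \<Sum>j<n. cnj (v i) * A $$ (i,j) * v j) + (\<Sum>i<n. \<Sum>j<n. cnj (v i) * B $$ (i,j) * v j)"
    using assms by (intro add_nonneg_nonneg psd_form)
  also have "\<dots> = (\<Sum>i<n. \<Sum>j<n. cnj (v i) * (A + B) $$ (i,j) * v j)"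
    unfolding sum.distrib[symmetric] using c by (intro sum.cong) (auto simp: algebra_simps)
  finally show "0 \<le> (\<Sum>i<n. \<Sum>j<n. cnj (v i) * (A + B) $$ (i,j) * v j)" .
qed

lemma psd_zero: "psd n (0\<^sub>m n n)"
  unfolding psd_iff by (auto intro!: sum_nonneg)

lemma psd_transpose:
  assumes "psd n A" shows "psd n A\<^sup>T"
  unfolding psd_iff
proof (intro conjI allI)
  show "A\<^sup>T \<in> carrier_mat n n" using assms psd_carrier by auto
  fix v
  have "0 \<le> (\<Sum>i<n. \<Sum>j<n. cnj (cnj (v i)) * A $$ (i,j) * cnj (v j))"
    using assms by (rule psd_form)
  also have "\<dots> = (\<Sum>i<n. \<Sum>j<n. cnj (v i) * A\<^sup>T $$ (i,j) * v j)"
    using psd_carrier[OF assms] by (subst sum.swap) (auto intro!: sum.cong)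
  finally show "0 \<le> (\<Sum>i<n. \<Sum>j<n. cnj (v i) * A\<^sup>T $$ (i,j) * v j)" .
qed

text \<open>The form of \<open>X * A * adj X\<close> at \<open>v\<close> is the form of
  \<open>A\<close> at \<open>adj X\<close> applied to \<open>v\<close>, which is \<open>?w\<close>
  below.\<close>

lemma psd_congruence:
  assumes "psd n A" "X \<in> carrier_mat m n" shows "psd m (X * A * adj X)"
  unfolding psd_iff
proof (intro conjI allI)
  have A: "A \<in> carrier_mat n n" using assms psd_carrier by auto
  then show "X * A * adj X \<in> carrier_mat m m"
    using assms(2) by (metis adj_carrier mult_carrier_mat)
  fix v
  let ?w = "\<lambda>k. \<Sum>i<m. cnj (X $$ (i,k)) * v i"
  have "(\<Sum>i<m. \<Sum>j<m. cnj (v i) * (X * A * adj X) $$ (i,j) * v j)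
     = (\<Sum>i<m. \<Sum>j<m. \<Sum>l<n. \<Sum>k<n. cnj (v i) * X $$ (i,k) * A $$ (k,l) * (cnj (X $$ (j,l)) * v j))"
  proof (intro sum.cong refl)
    fix i j assume "i \<in> {..<m}" "j \<in> {..<m}"
    then have "(X * A * adj X) $$ (i,j) = (\<Sum>l<n. (\<Sum>k<n. X $$ (i,k) * A $$ (k,l)) * cnj (X $$ (j,l)))"
      using A assms(2) by (subst mult_mat_entry[of _ m n _ m])
        (auto intro!: sum.cong mult_carrier_mat[of _ m n] simp: mult_mat_entry[of X m n A n] simp del: index_mult_mat(1))
    then show "cnj (v i) * (X * A * adj X) $$ (i,j) * v j
        = (\<Sum>l<n. \<Sum>k<n. cnj (v i) * X $$ (i,k) * A $$ (k,l) * (cnj (X $$ (j,l)) * v j))"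
      by (simp add: sum_distrib_left sum_distrib_right mult_ac)
  qed
  also have "\<dots> = (\<Sum>k<n. \<Sum>l<n. \<Sum>i<m. \<Sum>j<m. cnj (v i) * X $$ (i,k) * A $$ (k,l) * (cnj (X $$ (j,l)) * v j))"
  proof -
    have "(\<Sum>i<m. \<Sum>j<m. \<Sum>l<n. \<Sum>k<n. F i j l k) = (\<Sum>k<n. \<Sum>l<n. \<Sum>i<m. \<Sum>j<m. F i j l k)"
      for F :: "nat \<Rightarrow> nat \<Rightarrow> nat \<Rightarrow> nat \<Rightarrow> complex"
    proof -
      have "(\<Sum>i<m. \<Sum>j<m. \<Sum>l<n. \<Sum>k<n. F i j l k)
          = (\<Sum>(i,j)\<in>{..<m} \<times> {..<m}. \<Sum>(l,k)\<in>{..<n} \<times> {..<n}. F i j l k)"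
        by (simp add: sum.cartesian_product[symmetric])
      also have "\<dots> = (\<Sum>(l,k)\<in>{..<n} \<times> {..<n}. \<Sum>(i,j)\<in>{..<m} \<times> {..<m}. F i j l k)"
        unfolding split_def by (rule sum.swap)
      also have "\<dots> = (\<Sum>l<n. \<Sum>k<n. \<Sum>i<m. \<Sum>j<m. F i j l k)"
        by (simp add: sum.cartesian_product[symmetric])
      also have "\<dots> = (\<Sum>k<n. \<Sum>l<n. \<Sum>i<m. \<Sum>j<m. F i j l k)" by (rule sum.swap)
      finally show ?thesis .
    qed
    then show ?thesis .
  qed
  also have "\<dots> = (\<Sum>k<n. \<Sum>l<n. cnj (?w k) * A $$ (k,l) * ?w l)"
    by (intro sum.cong refl) (simp add: sum_distrib_left sum_distrib_right mult_ac)
  finally show "0 \<le> (\<Sum>i<m. \<Sum>j<m. cnj (v i) * (X * A * adj X) $$ (i,j) * v j)"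
    using psd_form[OF assms(1), of ?w] by simp
qed

lemma psd_one: "psd n (1\<^sub>m n)"
  unfolding psd_iff
proof (intro conjI allI)
  fix v :: "nat \<Rightarrow> complex"
  have "(\<Sum>i<n. \<Sum>j<n. cnj (v i) * 1\<^sub>m n $$ (i,j) * v j) = (\<Sum>i<n. \<Sum>j<n. if j = i then cnj (v i) * v i else 0)"
    by (intro sum.cong refl) auto
  also have "\<dots> = (\<Sum>i<n. cnj (v i) * v i)" by (intro sum.cong refl) (auto simp: sum.delta)
  also have "\<dots> \<ge> 0" by (intro sum_nonneg) (simp add: less_eq_complex_def)
  finally show "0 \<le> (\<Sum>i<n. \<Sum>j<n. cnj (v i) * 1\<^sub>m n $$ (i,j) * v j)" .
qed simp

lemma psd_gram: "X \<in> carrier_mat m n \<Longrightarrow> psd m (X * adj X)"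
  using psd_congruence[OF psd_one, of X m n] by simp

text \<open>The trace in question is the squared Hilbert-Schmidt norm, the sum of the squared moduli
  of all entries.\<close>

lemma mtrace_mult_adj_eq_0:
  assumes "X \<in> carrier_mat m n" "mtrace (X * adj X) = 0" shows "X = 0\<^sub>m m n"
proof (rule eq_matI)
  fix i j assume "i < dim_row (0\<^sub>m m n :: complex mat)" "j < dim_col (0\<^sub>m m n :: complex mat)"
  then have ij: "i < m" "j < n" by auto
  have "mtrace (X * adj X) = (\<Sum>i<m. \<Sum>j<n. complex_of_real ((cmod (X $$ (i,j)))\<^sup>2))"
    using assms(1) by (subst mtrace_mult[of _ m n]) (auto intro!: sum.cong simp: complex_norm_square simp del: of_real_power)
  also have "\<dots> = of_real (\<Sum>i<m. \<Sum>j<n. (cmod (X $$ (i,j)))\<^sup>2)" by simp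
  finally have "(\<Sum>i<m. \<Sum>j<n. (cmod (X $$ (i,j)))\<^sup>2) = 0"
    using assms(2) by (metis of_real_eq_0_iff)
  then have "\<forall>i\<in>{..<m}. (\<Sum>j<n. (cmod (X $$ (i,j)))\<^sup>2) = 0"
    by (subst (asm) sum_nonneg_eq_0_iff) (auto intro: sum_nonneg)
  then have "(\<Sum>j<n. (cmod (X $$ (i,j)))\<^sup>2) = 0" using ij by blast
  then have "\<forall>j\<in>{..<n}. (cmod (X $$ (i,j)))\<^sup>2 = 0"
    by (subst (asm) sum_nonneg_eq_0_iff) auto
  then show "X $$ (i,j) = 0\<^sub>m m n $$ (i,j)" using ij by simp
qed (use assms in auto)

subsection \<open>Spectral theorem and positive square roots\<close>

text \<open>The diagonal of a Schur form lists the eigenvalues with multiplicity and sums to the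
  trace. If all \<open>n\<close> of them were \<open>c\<close>, the trace would be
  \<open>of_nat n * c\<close>.\<close>

lemma exists_eigenvalue_ne:
  fixes A :: "complex mat"
  assumes A: "A \<in> carrier_mat n n" and tr: "mtrace A \<noteq> of_nat n * c"
  obtains e w where "e \<noteq> c" "\<exists>i<n. w i \<noteq> 0" "\<And>i. i < n \<Longrightarrow> (\<Sum>j<n. A $$ (i,j) * w j) = e * w i"
proof -
  obtain es where es: "char_poly A = (\<Prod>a\<leftarrow>es. [:- a, 1:])" "length es = n"
    using char_poly_factorized[OF A] by blast
  obtain B P Q where "schur_decomposition A es = (B, P, Q)" by (metis prod_cases3)
  then have sim: "similar_mat_wit A B P Q" and dB: "diag_mat B = es"
    using schur_decomposition[OF A es(1)] by auto
  have BPQ: "B \<in> carrier_mat n n" "P \<in> carrier_mat n n" "Q \<in> carrier_mat n n"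
      "Q * P = 1\<^sub>m n" "A = P * B * Q"
    using sim A unfolding similar_mat_wit_def Let_def by auto
  have "mtrace A = mtrace (Q * (P * B))"
    unfolding BPQ(5) using BPQ(1-3) by (intro mtrace_mult_commute[of _ n n]) auto
  also have "Q * (P * B) = B"
    using BPQ(1-4) by (simp add: assoc_mult_mat[symmetric, of _ n n _ n _ n])
  also have "mtrace B = sum_list (diag_mat B)"
    using BPQ(1) unfolding mtrace_def diag_mat_def by (simp add: sum_list_sum_nth atLeast0LessThan)
  finally have tr': "mtrace A = sum_list es" using dB by simp
  have "\<exists>e\<in>set es. e \<noteq> c"
  proof (rule ccontr)
    assume "\<not> ?thesis"
    then have "es = replicate n c" using es(2) by (intro replicate_eqI) auto
    then show False using tr tr' by (simp add: sum_list_replicate)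
  qed
  then obtain e where e: "e \<in> set es" "e \<noteq> c" by blast
  have "poly (char_poly A) e = 0"
    using e(1) unfolding es(1) poly_prod_list by (auto simp: prod_list_zero_iff)
  then obtain v where v: "eigenvector A v e"
    using eigenvalue_root_char_poly[OF A] unfolding eigenvalue_def by blast
  then have vc: "v \<in> carrier_vec n" "v \<noteq> 0\<^sub>v n" "A *\<^sub>v v = e \<cdot>\<^sub>v v"
    using A unfolding eigenvector_def by auto
  show thesis
  proof (rule that[of e "\<lambda>i. v $ i"])
    show "\<exists>i<n. v $ i \<noteq> 0" using vc by (metis carrier_vecD eq_vecI index_zero_vec)
    fix i assume i: "i < n"
    have "(A *\<^sub>v v) $ i = (\<Sum>j<n. A $$ (i,j) * v $ j)"
      using i A vc(1) by (auto simp: scalar_prod_def lessThan_atLeast0)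
    then show "(\<Sum>j<n. A $$ (i,j) * v $ j) = e * v $ i" using vc i by auto
  qed fact
qed

lemma hermitian_form_swap:
  assumes "\<And>i j. i < n \<Longrightarrow> j < n \<Longrightarrow> A $$ (j,i) = cnj (A $$ (i,j))"
  shows "(\<Sum>i<n. cnj (x i) * (\<Sum>j<n. A $$ (i,j) * y j)) = (\<Sum>i<n. cnj (\<Sum>j<n. A $$ (i,j) * x j) * y i)"
proof -
  have "(\<Sum>i<n. cnj (x i) * (\<Sum>j<n. A $$ (i,j) * y j)) = (\<Sum>i<n. \<Sum>j<n. cnj (x i) * A $$ (i,j) * y j)"
    by (simp add: sum_distrib_left mult.assoc)
  also have "\<dots> = (\<Sum>j<n. \<Sum>i<n. cnj (x i) * A $$ (i,j) * y j)" by (rule sum.swap)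
  also have "\<dots> = (\<Sum>i<n. cnj (\<Sum>j<n. A $$ (i,j) * x j) * y i)"
    unfolding cnj_sum sum_distrib_right
  proof (intro sum.cong refl)
    fix j i assume "j \<in> {..<n}" "i \<in> {..<n}"
    then show "cnj (x i) * A $$ (i,j) * y j = cnj (A $$ (j,i) * x i) * y j"
      using assms[of j i] by simp
  qed
  finally show ?thesis .
qed

text \<open>Moves \<open>A\<close> from one side of the inner product to the other. With
  \<open>x = y\<close> it makes an eigenvalue real; with distinct real eigenvalues it makes the
  eigenvectors orthogonal.\<close>

lemma hermitian_eigen_form:
  assumes "\<And>i j. i < n \<Longrightarrow> j < n \<Longrightarrow> A $$ (j,i) = cnj (A $$ (i,j))"
    and x: "\<And>i. i < n \<Longrightarrow> (\<Sum>j<n. A $$ (i,j) * x j) = \<alpha> * x i"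
    and y: "\<And>i. i < n \<Longrightarrow> (\<Sum>j<n. A $$ (i,j) * y j) = \<beta> * y i"
  shows "\<beta> * (\<Sum>i<n. cnj (x i) * y i) = cnj \<alpha> * (\<Sum>i<n. cnj (x i) * y i)"
proof -
  have "\<beta> * (\<Sum>i<n. cnj (x i) * y i) = (\<Sum>i<n. cnj (x i) * (\<Sum>j<n. A $$ (i,j) * y j))"
    unfolding sum_distrib_left[of \<beta>] by (intro sum.cong refl) (simp add: y mult.left_commute)
  also have "\<dots> = (\<Sum>i<n. cnj (\<Sum>j<n. A $$ (i,j) * x j) * y i)"
    using assms(1) by (rule hermitian_form_swap)
  also have "\<dots> = cnj \<alpha> * (\<Sum>i<n. cnj (x i) * y i)"
    unfolding sum_distrib_left[of "cnj \<alpha>"]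
    by (intro sum.cong refl) (simp only: x lessThan_iff complex_cnj_mult mult.assoc)
  finally show ?thesis .
qed

text \<open>Deflation: shifting the eigenvalues already found to a common real value \<open>c\<close> with
  the wrong trace forces an eigenvalue different from \<open>c\<close>, whose eigenvector is then orthogonal
  to the earlier ones.\<close>

lemma orthonormal_eigenvectors:
  fixes A :: "complex mat"
  assumes A: "A \<in> carrier_mat n n" and herm: "adj A = A" and "k \<le> n"
  shows "\<exists>(u :: nat \<Rightarrow> nat \<Rightarrow> complex) (l :: nat \<Rightarrow> real).
    (\<forall>a<k. \<forall>b<k. (\<Sum>i<n. cnj (u a i) * u b i) = (if a = b then 1 else 0)) \<and>
    (\<forall>a<k. \<forall>i<n. (\<Sum>j<n. A $$ (i,j) * u a j) = of_real (l a) * u a i)"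
  using \<open>k \<le> n\<close>
proof (induction k)
  case 0
  then show ?case by simp
next
  case (Suc k)
  obtain u :: "nat \<Rightarrow> nat \<Rightarrow> complex" and l :: "nat \<Rightarrow> real" where ul:
    "(\<forall>a<k. \<forall>b<k. (\<Sum>i<n. cnj (u a i) * u b i) = (if a = b then 1 else 0)) \<and>
     (\<forall>a<k. \<forall>i<n. (\<Sum>j<n. A $$ (i,j) * u a j) = of_real (l a) * u a i)"
    using Suc.IH[OF Suc_leD[OF Suc.prems]] by (elim exE) (rule that)
  have orth: "(\<Sum>i<n. cnj (u a i) * u b i) = (if a = b then 1 else 0)" if "a < k" "b < k" for a b
    using ul that by simp
  have eig: "(\<Sum>j<n. A $$ (i,j) * u a j) = of_real (l a) * u a i" if "a < k" "i < n" for a i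
    using ul that by simp
  have k: "k < n" using Suc.prems by simp
  have hA: "A $$ (j,i) = cnj (A $$ (i,j))" if "i < n" "j < n" for i j
    using herm that A by (metis adj_entry carrier_matD)
  \<comment> \<open>\<open>t\<close> is the part of the trace not accounted for by the eigenvalues
    already found. The value of \<open>c\<close> is chosen so that the real part of
    \<open>mtrace A'\<close> falls short of \<open>n * c\<close> by exactly 1.\<close>
  define t where "t = Re (mtrace A) - (\<Sum>a<k. l a)"
  define c where "c = (t + 1) / (real n - real k)"
  define A' where "A' = mat n n (\<lambda>(i,j). A $$ (i,j) + (\<Sum>a<k. of_real (c - l a) * u a i * cnj (u a j)))"
  have A'c: "A' \<in> carrier_mat n n" by (simp add: A'_def)
  have hA': "A' $$ (j,i) = cnj (A' $$ (i,j))" if "i < n" "j < n" for i j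
    using that hA[OF that] by (simp add: A'_def mult_ac)
  have act: "(\<Sum>j<n. A' $$ (i,j) * x j) = (\<Sum>j<n. A $$ (i,j) * x j)
      + (\<Sum>a<k. of_real (c - l a) * u a i * (\<Sum>j<n. cnj (u a j) * x j))" if "i < n" for i x
  proof -
    have "(\<Sum>j<n. A' $$ (i,j) * x j) = (\<Sum>j<n. A $$ (i,j) * x j)
        + (\<Sum>j<n. \<Sum>a<k. of_real (c - l a) * u a i * (cnj (u a j) * x j))"
      unfolding sum.distrib[symmetric] using that
      by (intro sum.cong refl) (simp add: A'_def distrib_right sum_distrib_right mult.assoc)
    also have "(\<Sum>j<n. \<Sum>a<k. of_real (c - l a) * u a i * (cnj (u a j) * x j))
        = (\<Sum>a<k. of_real (c - l a) * u a i * (\<Sum>j<n. cnj (u a j) * x j))"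
      by (subst sum.swap) (simp add: sum_distrib_left)
    finally show ?thesis .
  qed
  have actu: "(\<Sum>j<n. A' $$ (i,j) * u b j) = of_real c * u b i" if "b < k" "i < n" for b i
  proof -
    have "(\<Sum>a<k. of_real (c - l a) * u a i * (\<Sum>j<n. cnj (u a j) * u b j))
        = (\<Sum>a<k. if a = b then of_real (c - l b) * u b i else 0)"
      using that orth by (intro sum.cong refl) auto
    also have "\<dots> = of_real (c - l b) * u b i" using that by simp
    finally show ?thesis unfolding act[OF that(2)] eig[OF that] by (simp add: left_diff_distrib)
  qed
  have "mtrace A' = mtrace A + (\<Sum>i<n. \<Sum>a<k. of_real (c - l a) * (cnj (u a i) * u a i))"
    unfolding mtrace_sum[OF A'c] mtrace_sum[OF A] sum.distrib[symmetric]
    by (intro sum.cong refl) (simp add: A'_def mult_ac)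
  also have "(\<Sum>i<n. \<Sum>a<k. of_real (c - l a) * (cnj (u a i) * u a i))
      = (\<Sum>a<k. of_real (c - l a) * (\<Sum>i<n. cnj (u a i) * u a i))"
    by (subst sum.swap) (simp add: sum_distrib_left)
  also have "\<dots> = (\<Sum>a<k. of_real (c - l a))" using orth by simp
  finally have "Re (mtrace A') = t + k * c" by (simp add: t_def sum_subtractf)
  moreover have "real n * c - k * c = t + 1"
  proof -
    have "(real n - real k) * c = t + 1" using k by (simp add: c_def)
    then show ?thesis by (simp only: left_diff_distrib)
  qed
  ultimately have neq: "mtrace A' \<noteq> of_nat n * of_real c" by auto
  obtain e w where e: "e \<noteq> of_real c" and w0: "\<exists>i<n. w i \<noteq> 0" and
    w: "\<And>i. i < n \<Longrightarrow> (\<Sum>j<n. A' $$ (i,j) * w j) = e * w i"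
    using exists_eigenvalue_ne[OF A'c neq] by blast
  define N where "N = (\<Sum>i<n. (cmod (w i))\<^sup>2)"
  have N: "(\<Sum>i<n. cnj (w i) * w i) = of_real N"
    unfolding N_def of_real_sum by (intro sum.cong refl) (metis complex_norm_square mult.commute of_real_power)
  obtain i0 where "i0 < n" "w i0 \<noteq> 0" using w0 by blast
  then have Npos: "N > 0"
    unfolding N_def by (intro sum_pos2[of _ i0]) auto
  \<comment> \<open>Pairing the eigenvector with itself shows that \<open>e\<close> is real.\<close>
  have "e * of_real N = cnj e * of_real N"
    unfolding N[symmetric] by (rule hermitian_eigen_form[OF hA' w w])
  then have e_real: "e = of_real (Re e)" using Npos by (simp add: complex_eq_iff)
  have uw: "(\<Sum>i<n. cnj (u b i) * w i) = 0" if "b < k" for b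
  proof -
    have "e * (\<Sum>i<n. cnj (u b i) * w i) = of_real c * (\<Sum>i<n. cnj (u b i) * w i)"
      using hermitian_eigen_form[OF hA' actu[OF that] w] by simp
    then show ?thesis using e by simp
  qed
  have wu: "(\<Sum>i<n. cnj (w i) * u b i) = 0" if "b < k" for b
    using arg_cong[OF uw[OF that], of cnj] by (simp add: mult.commute)
  \<comment> \<open>Orthogonality to all earlier \<open>u b\<close> kills the terms that distinguish
    \<open>A'\<close> from \<open>A\<close>, so \<open>w\<close> is an eigenvector of
    \<open>A\<close> itself.\<close>
  have Aw: "(\<Sum>j<n. A $$ (i,j) * w j) = e * w i" if "i < n" for i
    using w[OF that] act[OF that, of w] uw by simp
  define s where "s = complex_of_real (1 / sqrt N)"
  have s: "cnj s = s" "s * s * of_real N = 1"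
  proof -
    show "cnj s = s" by (simp add: s_def)
    have "(1 / sqrt N) * (1 / sqrt N) * N = 1" using Npos by simp
    then show "s * s * of_real N = 1" unfolding s_def of_real_mult[symmetric] by simp
  qed
  define u' where "u' = u(k := \<lambda>i. s * w i)"
  define l' where "l' = l(k := Re e)"
  have kk: "(\<Sum>i<n. cnj (s * w i) * (s * w i)) = 1"
  proof -
    have "(\<Sum>i<n. cnj (s * w i) * (s * w i)) = s * s * (\<Sum>i<n. cnj (w i) * w i)"
      by (simp add: s(1) sum_distrib_left mult_ac)
    then show ?thesis using s N by simp
  qed
  have ku: "(\<Sum>i<n. cnj (s * w i) * u b i) = 0" if "b < k" for b
  proof -
    have "(\<Sum>i<n. cnj (s * w i) * u b i) = s * (\<Sum>i<n. cnj (w i) * u b i)"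
      by (simp add: s(1) sum_distrib_left mult_ac)
    then show ?thesis using wu that by simp
  qed
  have uk: "(\<Sum>i<n. cnj (u b i) * (s * w i)) = 0" if "b < k" for b
  proof -
    have "(\<Sum>i<n. cnj (u b i) * (s * w i)) = s * (\<Sum>i<n. cnj (u b i) * w i)"
      by (simp add: sum_distrib_left mult_ac)
    then show ?thesis using uw that by simp
  qed
  have orth': "(\<Sum>i<n. cnj (u' a i) * u' b i) = (if a = b then 1 else 0)" if "a < Suc k" "b < Suc k" for a b
    using that orth kk ku uk unfolding u'_def by (auto simp: less_Suc_eq)
  have eig': "(\<Sum>j<n. A $$ (i,j) * u' a j) = of_real (l' a) * u' a i" if "a < Suc k" "i < n" for a i
  proof (cases "a = k")
    case True
    have "(\<Sum>j<n. A $$ (i,j) * (s * w j)) = s * (\<Sum>j<n. A $$ (i,j) * w j)"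
      by (simp add: sum_distrib_left mult_ac)
    also have "\<dots> = of_real (Re e) * (s * w i)"
      using Aw[OF that(2)] e_real by (metis mult.left_commute)
    finally show ?thesis using True by (simp add: u'_def l'_def)
  next
    case False
    then show ?thesis using that eig by (simp add: u'_def l'_def)
  qed
  show ?case
    using orth' eig' by (intro exI[of _ u'] exI[of _ l'] conjI allI impI)
qed

section \<open>Functional calculus in a fixed eigenbasis\<close>

definition real_diag :: "nat \<Rightarrow> (nat \<Rightarrow> real) \<Rightarrow> complex mat" where
  "real_diag n f = mat n n (\<lambda>(i,j). if i = j then of_real (f i) else 0)"

definition unitary :: "nat \<Rightarrow> complex mat \<Rightarrow> bool" where
  "unitary n U \<longleftrightarrow> U \<in> carrier_mat n n \<and> U * adj U = 1\<^sub>m n \<and> adj U * U = 1\<^sub>m n"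

text \<open>Keeping the basis \<open>U\<close> apart from the eigenvalues \<open>f\<close> makes
  products, traces, square roots and absolute values pointwise operations on
  \<open>f\<close>.\<close>

definition spectral :: "nat \<Rightarrow> complex mat \<Rightarrow> (nat \<Rightarrow> real) \<Rightarrow> complex mat" where
  "spectral n U f = U * real_diag n f * adj U"

lemma real_diag_carrier [simp]: "real_diag n f \<in> carrier_mat n n"
  by (simp add: real_diag_def)

lemma unitary_carrier: "unitary n U \<Longrightarrow> U \<in> carrier_mat n n"
  by (simp add: unitary_def)

lemma spectral_carrier: "unitary n U \<Longrightarrow> spectral n U f \<in> carrier_mat n n"
  unfolding spectral_def unitary_def by (metis adj_carrier mult_carrier_mat real_diag_carrier)

theorem hermitian_spectral_decomposition:
  assumes A: "A \<in> carrier_mat n n" and herm: "adj A = A"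
  obtains U l where "unitary n U" "A = spectral n U l"
proof -
  obtain u :: "nat \<Rightarrow> nat \<Rightarrow> complex" and l :: "nat \<Rightarrow> real" where
    orth: "\<And>a b. a < n \<Longrightarrow> b < n \<Longrightarrow> (\<Sum>i<n. cnj (u a i) * u b i) = (if a = b then 1 else 0)" and
    eig: "\<And>a i. a < n \<Longrightarrow> i < n \<Longrightarrow> (\<Sum>j<n. A $$ (i,j) * u a j) = of_real (l a) * u a i"
    using orthonormal_eigenvectors[OF A herm order.refl] by blast
  define U where "U = mat n n (\<lambda>(i,a). u a i)"
  have U: "U \<in> carrier_mat n n" by (simp add: U_def)
  have UU: "adj U * U = 1\<^sub>m n"
  proof (rule eq_matI)
    fix a b assume "a < dim_row (1\<^sub>m n :: complex mat)" "b < dim_col (1\<^sub>m n :: complex mat)"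
    then show "(adj U * U) $$ (a,b) = 1\<^sub>m n $$ (a,b)"
      using U orth by (subst mult_mat_entry[of _ n n _ n]) (auto simp: U_def)
  qed (use U in \<open>auto simp: adj_def\<close>)
  have UU': "U * adj U = 1\<^sub>m n"
    using mat_mult_left_right_inverse[OF _ U UU] U by simp
  have "A * U = U * real_diag n l"
  proof (rule eq_matI)
    fix i a assume "i < dim_row (U * real_diag n l)" "a < dim_col (U * real_diag n l)"
    then have ia: "i < n" "a < n" using U by (auto simp: real_diag_def)
    have "(A * U) $$ (i,a) = of_real (l a) * u a i"
      using A U ia eig by (subst mult_mat_entry[of _ n n _ n]) (auto simp: U_def)
    also have "\<dots> = (\<Sum>j<n. if j = a then U $$ (i,a) * of_real (l a) else 0)"
      using ia by (simp add: U_def)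
    also have "\<dots> = (\<Sum>j<n. U $$ (i,j) * real_diag n l $$ (j,a))"
      using ia by (intro sum.cong) (auto simp: real_diag_def)
    also have "\<dots> = (U * real_diag n l) $$ (i,a)"
      using U ia by (intro mult_mat_entry[symmetric]) auto
    finally show "(A * U) $$ (i,a) = (U * real_diag n l) $$ (i,a)" .
  qed (use A U in \<open>auto simp: real_diag_def\<close>)
  then have "spectral n U l = A * U * adj U" by (simp add: spectral_def)
  also have "\<dots> = A" using A U UU' by (simp add: assoc_mult_mat[of _ n n _ n _ n])
  finally have "A = spectral n U l" ..
  then show thesis using that U UU UU' unfolding unitary_def by blast
qed

lemma real_diag_mult: "real_diag n f * real_diag n g = real_diag n (\<lambda>i. f i * g i)"
proof (rule eq_matI)
  fix i j assume "i < dim_row (real_diag n (\<lambda>i. f i * g i))" "j < dim_col (real_diag n (\<lambda>i. f i * g i))"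
  then have ij: "i < n" "j < n" by (auto simp: real_diag_def)
  have "(real_diag n f * real_diag n g) $$ (i,j) = (\<Sum>l<n. real_diag n f $$ (i,l) * real_diag n g $$ (l,j))"
    using ij by (intro mult_mat_entry) auto
  also have "\<dots> = (\<Sum>l<n. if l = i then (if i = j then of_real (f i * g i) else 0) else 0)"
    using ij by (intro sum.cong) (auto simp: real_diag_def)
  also have "\<dots> = real_diag n (\<lambda>i. f i * g i) $$ (i,j)" using ij by (simp add: real_diag_def)
  finally show "(real_diag n f * real_diag n g) $$ (i,j) = real_diag n (\<lambda>i. f i * g i) $$ (i,j)" .
qed (auto simp: real_diag_def)

lemma adj_real_diag: "adj (real_diag n f) = real_diag n f"
  by (rule eq_matI) (auto simp: real_diag_def adj_def)

lemma unitary_conj_cancel: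
  assumes "unitary n U" "X \<in> carrier_mat n n"
  shows "adj U * (U * X * adj U) * U = X"
proof -
  have U: "U \<in> carrier_mat n n" "adj U * U = 1\<^sub>m n" "adj U \<in> carrier_mat n n"
    using assms by (auto simp: unitary_def)
  have "adj U * (U * X * adj U) * U = (adj U * U) * X * (adj U * U)"
    using U(1,3) assms(2) by (simp add: assoc_mult_mat[of _ n n _ n _ n])
  also have "\<dots> = X" unfolding U(2) using assms(2) by (simp add: left_mult_one_mat[of _ n n])
  finally show ?thesis .
qed

lemma spectral_mult:
  assumes "unitary n U"
  shows "spectral n U f * spectral n U g = spectral n U (\<lambda>i. f i * g i)"
proof -
  have U: "U \<in> carrier_mat n n" "adj U * U = 1\<^sub>m n" "adj U \<in> carrier_mat n n"
    using assms by (auto simp: unitary_def)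
  have "spectral n U f * spectral n U g = U * real_diag n f * (adj U * U) * (real_diag n g * adj U)"
    unfolding spectral_def using U(1,3) by (simp add: assoc_mult_mat[of _ n n _ n _ n])
  also have "\<dots> = U * (real_diag n f * real_diag n g) * adj U"
    unfolding U(2) using U(1,3) by (simp add: assoc_mult_mat[of _ n n _ n _ n] left_mult_one_mat[of _ n n])
  finally show ?thesis by (simp add: real_diag_mult spectral_def)
qed

lemma mtrace_spectral:
  assumes "unitary n U" shows "mtrace (spectral n U f) = of_real (\<Sum>i<n. f i)"
proof -
  have U: "U \<in> carrier_mat n n" "adj U * U = 1\<^sub>m n" "adj U \<in> carrier_mat n n"
    using assms by (auto simp: unitary_def)
  have "mtrace (spectral n U f) = mtrace (adj U * (U * real_diag n f))"
    unfolding spectral_def using U by (intro mtrace_mult_commute[of _ n n]) auto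
  also have "adj U * (U * real_diag n f) = real_diag n f"
    using U by (simp add: assoc_mult_mat[symmetric, of _ n n _ n _ n] left_mult_one_mat[of _ n n])
  also have "mtrace \<dots> = of_real (\<Sum>i<n. f i)"
    by (subst mtrace_sum[of _ n]) (auto simp: real_diag_def)
  finally show ?thesis .
qed

lemma adj_spectral:
  assumes "unitary n U" shows "adj (spectral n U f) = spectral n U f"
proof -
  have U: "U \<in> carrier_mat n n" "adj U \<in> carrier_mat n n"
    using assms by (auto simp: unitary_def)
  have "adj (spectral n U f) = U * (adj (real_diag n f) * adj U)"
    unfolding spectral_def using U
    by (subst adj_mult[of _ n n _ n]) (auto simp: adj_mult[of _ n n _ n])
  then show ?thesis using U by (simp add: adj_real_diag spectral_def assoc_mult_mat[of _ n n _ n _ n])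
qed

lemma psd_spectral:
  assumes "unitary n U" "\<And>i. i < n \<Longrightarrow> 0 \<le> f i"
  shows "psd n (spectral n U f)"
proof -
  have "psd n (real_diag n f)"
  proof -
    have "real_diag n f = real_diag n (\<lambda>i. sqrt (f i) * sqrt (f i))"
      using assms(2) by (intro eq_matI) (auto simp: real_diag_def)
    also have "\<dots> = real_diag n (\<lambda>i. sqrt (f i)) * adj (real_diag n (\<lambda>i. sqrt (f i)))"
      by (simp add: adj_real_diag real_diag_mult)
    finally show ?thesis by (simp add: psd_gram[of _ n n])
  qed
  then show ?thesis unfolding spectral_def
    using assms(1) by (intro psd_congruence[of n]) (auto simp: unitary_def)
qed

lemma mtrace_unitary_conj:
  assumes "unitary n U" "X \<in> carrier_mat n n"
  shows "mtrace (adj U * X * U) = mtrace X"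
proof -
  have U: "U \<in> carrier_mat n n" "U * adj U = 1\<^sub>m n" "adj U \<in> carrier_mat n n"
    using assms by (auto simp: unitary_def)
  have "mtrace (adj U * X * U) = mtrace (U * (adj U * X))"
    using U assms(2) by (intro mtrace_mult_commute[of _ n n]) auto
  also have "U * (adj U * X) = X"
    using U assms(2) by (simp add: assoc_mult_mat[symmetric, of _ n n _ n _ n])
  finally show ?thesis .
qed

lemma psd_unitary_conj: "unitary n U \<Longrightarrow> psd n X \<Longrightarrow> psd n (adj U * X * U)"
  using psd_congruence[of n X "adj U" n] by (auto simp: unitary_def)

text \<open>Rotating \<open>A\<close> into its eigenbasis preserves positivity, and the eigenvalues
  are then diagonal entries of a positive semidefinite matrix.\<close>

lemma psd_spectral_decomposition:
  assumes "psd n A"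
  obtains U l where "unitary n U" "A = spectral n U l" "\<And>i. i < n \<Longrightarrow> 0 \<le> l i"
proof -
  obtain U l where U: "unitary n U" "A = spectral n U l"
    using hermitian_spectral_decomposition[OF psd_carrier[OF assms] psd_hermitian[OF assms]] .
  have "0 \<le> l i" if "i < n" for i
  proof -
    have "psd n (real_diag n l)"
      using psd_unitary_conj[OF U(1) assms] unitary_conj_cancel[OF U(1), of "real_diag n l"] U(2)
      by (simp add: spectral_def)
    then have "0 \<le> real_diag n l $$ (i,i)" using that by (rule psd_diag_nonneg)
    then show ?thesis using that by (simp add: real_diag_def less_eq_complex_def)
  qed
  with U show thesis by (rule that)
qed

section \<open>Positive square roots and evaluation of the trace norm\<close>

lemma psd_sqrt_exists:
  assumes "psd n A" obtains B where "psd n B" "B * B = A"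
proof -
  obtain U l where U: "unitary n U" "A = spectral n U l" "\<And>i. i < n \<Longrightarrow> 0 \<le> l i"
    using psd_spectral_decomposition[OF assms] by blast
  have "spectral n U (\<lambda>i. sqrt (l i)) * spectral n U (\<lambda>i. sqrt (l i)) = A"
  proof -
    have "real_diag n (\<lambda>i. sqrt (l i) * sqrt (l i)) = real_diag n l"
      using U(3) by (intro eq_matI) (auto simp: real_diag_def)
    then show ?thesis using spectral_mult[OF U(1)] U(2) by (simp add: spectral_def)
  qed
  moreover have "psd n (spectral n U (\<lambda>i. sqrt (l i)))"
    using U by (intro psd_spectral) auto
  ultimately show thesis using that by blast
qed

text \<open>With \<open>D = B - C\<close>, the positive semidefinite matrices
  \<open>D * B * D\<close> and \<open>D * C * D\<close> have traces summing to zero, so both vanish.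
  Their difference is the cube of \<open>D\<close>, and a Hermitian matrix with zero cube is zero.
  No common eigenbasis of \<open>B\<close> and \<open>C\<close> has to be constructed.\<close>

lemma psd_sqrt_unique:
  assumes B: "psd n B" and C: "psd n C" and eq: "B * B = C * C"
  shows "B = C"
proof -
  have c: "B \<in> carrier_mat n n" "C \<in> carrier_mat n n" using B C psd_carrier by auto
  define D where "D = B - C"
  have Dc: "D \<in> carrier_mat n n" using c by (simp add: D_def)
  have hD: "adj D = D"
    using adj_minus[OF c] psd_hermitian[OF B] psd_hermitian[OF C] by (simp add: D_def)
  have DX: "psd n (D * X * D)" if "psd n X" for X
    using psd_congruence[OF that Dc] hD by simp
  note assoc = assoc_mult_mat[of _ n n _ n _ n]
  have D3: "D * B * D - D * C * D = D * D * D"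
    using minus_mult_distrib_mat[of "D * B" n n "D * C" D n] mult_minus_distrib_mat[of D n n B n C] c Dc
    by (simp add: D_def[symmetric])
  \<comment> \<open>because \<open>D (B + C) + (B + C) D = 2 (B\<^sup>2 - C\<^sup>2) = 0\<close>\<close>
  have "mtrace (D * B * D) + mtrace (D * C * D) = 0"
  proof -
    have cyc: "mtrace (X * Y * Z) = mtrace (Y * Z * X)"
      if "X \<in> carrier_mat n n" "Y \<in> carrier_mat n n" "Z \<in> carrier_mat n n" for X Y Z
      using mtrace_mult_commute[of X n n "Y * Z"] that by (simp add: assoc)
    have "mtrace (D * X * D) = mtrace (D * X * B) - mtrace (D * X * C)" if "X \<in> carrier_mat n n" for X
    proof -
      have "D * X * D = D * X * B - D * X * C"
        using that c Dc mult_minus_distrib_mat[of "D * X" n n B n C] by (simp add: D_def)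
      then show ?thesis using that c Dc by (simp add: mtrace_minus[of _ n])
    qed
    from this[OF c(1)] this[OF c(2)]
    have "mtrace (D * B * D) + mtrace (D * C * D)
      = mtrace (D * B * B) - mtrace (D * B * C) + mtrace (D * C * B) - mtrace (D * C * C)" by simp
    moreover have "mtrace (D * B * B) = mtrace (D * C * C)"
      using eq c Dc by (simp add: assoc)
    \<comment> \<open>Expanding the leading \<open>D\<close> leaves traces of words in
      \<open>B\<close> and \<open>C\<close> that agree up to cyclic rotation.\<close>
    moreover have "mtrace (D * B * C) = mtrace (D * C * B)"
    proof -
      have 1: "mtrace (D * X * Y) = mtrace (B * X * Y) - mtrace (C * X * Y)"
        if "X \<in> carrier_mat n n" "Y \<in> carrier_mat n n" for X Y
      proof -
        have "D * X * Y = B * X * Y - C * X * Y"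
          using that c by (simp add: D_def minus_mult_distrib_mat[of _ n n _ _ n])
        then show ?thesis using that c by (simp add: mtrace_minus[of _ n])
      qed
      have "mtrace (B * B * C) = mtrace (B * C * B)" using cyc[OF c(1) c(1) c(2)] .
      moreover have "mtrace (C * B * C) = mtrace (C * C * B)" using cyc[OF c(2) c(2) c(1)] cyc[OF c(2) c(1) c(2)] cyc[OF c(1) c(2) c(2)] by simp
      ultimately show ?thesis using 1[OF c] 1[OF c(2,1)] by simp
    qed
    ultimately show ?thesis by simp
  qed
  moreover have "0 \<le> mtrace (D * B * D)" "0 \<le> mtrace (D * C * D)"
    using DX B C psd_trace_nonneg by blast+
  ultimately have "mtrace (D * B * D) = 0" "mtrace (D * C * D) = 0"
    by (simp_all add: add_nonneg_eq_0_iff)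
  then have "D * B * D = 0\<^sub>m n n" "D * C * D = 0\<^sub>m n n"
    using DX B C psd_trace_zero by blast+
  then have D30: "D * D * D = 0\<^sub>m n n" using D3 minus_r_inv_mat[of "0\<^sub>m n n :: complex mat" n n] by simp
  \<comment> \<open>Hermiticity turns the Hilbert-Schmidt norm of the square into the trace of the
    fourth power, which is zero; the same argument then descends from the square to
    \<open>D\<close>.\<close>
  have "(D * D) * adj (D * D) = (D * D * D) * D"
    using Dc hD by (simp add: adj_mult[of _ n n _ n] assoc)
  then have "mtrace ((D * D) * adj (D * D)) = 0" using D30 Dc by (simp add: mtrace_def)
  then have "D * D = 0\<^sub>m n n" using Dc by (intro mtrace_mult_adj_eq_0) auto
  then have "mtrace (D * adj D) = 0" using hD by (simp add: mtrace_def)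
  then have "D = 0\<^sub>m n n" using Dc by (intro mtrace_mult_adj_eq_0) auto
  show ?thesis
  proof (rule eq_matI)
    fix i j assume "i < dim_row C" "j < dim_col C"
    then have ij: "i < n" "j < n" using c by auto
    have "D $$ (i,j) = 0" using \<open>D = 0\<^sub>m n n\<close> ij by simp
    then show "B $$ (i,j) = C $$ (i,j)" using c ij by (simp add: D_def)
  qed (use c in auto)
qed

text \<open>Uniqueness of the root resolves the definite description, so a trace norm is computed by
  exhibiting any positive semidefinite root.\<close>

lemma trace_norm_eqI:
  assumes "A \<in> carrier_mat m n" "psd n B" "B * B = adj A * A"
  shows "trace_norm A = Re (mtrace B)"
proof -
  have "(THE B. psd (dim_col A) B \<and> B * B = adj A * A) = B"
    using assms psd_sqrt_unique by (intro the_equality) auto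
  then show ?thesis by (simp add: trace_norm_def)
qed

lemma trace_norm_spectral:
  assumes "unitary n U" shows "trace_norm (spectral n U l) = (\<Sum>i<n. \<bar>l i\<bar>)"
proof -
  have "trace_norm (spectral n U l) = Re (mtrace (spectral n U (\<lambda>i. \<bar>l i\<bar>)))"
    using assms by (intro trace_norm_eqI[of _ n n])
      (auto simp: spectral_carrier psd_spectral adj_spectral spectral_mult)
  then show ?thesis using assms by (simp add: mtrace_spectral)
qed

subsection \<open>Trace norm bounds from positive splittings\<close>

text \<open>For Hermitian \<open>A\<close> this is equivalent to \<open>trace_norm A \<le> t\<close>, but it passes to sums and
  through channels without a triangle inequality for the trace norm.\<close>

definition psd_split :: "nat \<Rightarrow> complex mat \<Rightarrow> real \<Rightarrow> bool" where
  "psd_split n A t \<longleftrightarrow> (\<exists>P Q. psd n P \<and> psd n Q \<and> A = P - Q \<and> Re (mtrace P) + Re (mtrace Q) \<le> t)"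

text \<open>In an eigenbasis of \<open>A\<close>, each eigenvalue is the difference of nonnegative
  diagonal entries of the rotated \<open>P\<close> and \<open>Q\<close>, hence bounded in modulus by
  their sum. Rotation leaves both traces unchanged.\<close>

lemma psd_split_trace_norm:
  assumes "psd_split n A t" shows "trace_norm A \<le> t"
proof -
  obtain P Q where P: "psd n P" and Q: "psd n Q" and A: "A = P - Q"
    and t: "Re (mtrace P) + Re (mtrace Q) \<le> t"
    using assms unfolding psd_split_def by blast
  have c: "P \<in> carrier_mat n n" "Q \<in> carrier_mat n n" using P Q psd_carrier by auto
  have "adj A = A" unfolding A adj_minus[OF c] using P Q by (simp add: psd_hermitian)
  moreover have "A \<in> carrier_mat n n" unfolding A using c by simp
  ultimately obtain U l where U: "unitary n U" and Al: "A = spectral n U l"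
    using hermitian_spectral_decomposition by metis
  have Uc: "U \<in> carrier_mat n n" "adj U \<in> carrier_mat n n" using U unitary_carrier by auto
  let ?P = "adj U * P * U" and ?Q = "adj U * Q * U"
  have D: "real_diag n l = ?P - ?Q"
  proof -
    have "real_diag n l = adj U * A * U"
      using unitary_conj_cancel[OF U, of "real_diag n l"] Al by (simp add: spectral_def)
    also have "\<dots> = (adj U * P - adj U * Q) * U"
      unfolding A using mult_minus_distrib_mat[of "adj U" n n P n Q] c Uc by simp
    also have "\<dots> = ?P - ?Q"
      using c Uc by (intro minus_mult_distrib_mat[of _ n n _ _ n]) auto
    finally show ?thesis .
  qed
  have PQ: "psd n ?P" "psd n ?Q" using psd_unitary_conj U P Q by auto
  have "\<bar>l i\<bar> \<le> Re (?P $$ (i,i)) + Re (?Q $$ (i,i))" if i: "i < n" for i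
  proof -
    have "real_diag n l $$ (i,i) = ?P $$ (i,i) - ?Q $$ (i,i)"
      unfolding D using i psd_carrier[OF PQ(1)] psd_carrier[OF PQ(2)] by (intro index_minus_mat) auto
    then have "l i = Re (?P $$ (i,i)) - Re (?Q $$ (i,i))"
      using i by (simp add: real_diag_def complex_eq_iff del: index_mult_mat)
    moreover have "0 \<le> ?P $$ (i,i)" "0 \<le> ?Q $$ (i,i)"
      using psd_diag_nonneg[OF PQ(1) i] psd_diag_nonneg[OF PQ(2) i] .
    ultimately show ?thesis unfolding less_eq_complex_def zero_complex.sel by linarith
  qed
  then have "(\<Sum>i<n. \<bar>l i\<bar>) \<le> (\<Sum>i<n. Re (?P $$ (i,i)) + Re (?Q $$ (i,i)))"
    by (intro sum_mono) auto
  also have "\<dots> = Re (mtrace ?P) + Re (mtrace ?Q)"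
    unfolding mtrace_sum[OF psd_carrier[OF PQ(1)]] mtrace_sum[OF psd_carrier[OF PQ(2)]]
    by (simp add: sum.distrib del: index_mult_mat)
  also have "\<dots> \<le> t" using t c by (simp add: mtrace_unitary_conj[OF U])
  finally show ?thesis unfolding Al trace_norm_spectral[OF U] .
qed

text \<open>The Jordan decomposition into positive and negative parts attains the trace
  norm.\<close>

lemma psd_split_hermitian:
  assumes "A \<in> carrier_mat n n" "adj A = A"
  shows "psd_split n A (trace_norm A)"
proof -
  obtain U l where U: "unitary n U" and A: "A = spectral n U l"
    using hermitian_spectral_decomposition[OF assms] .
  have Uc: "U \<in> carrier_mat n n" "adj U \<in> carrier_mat n n" using U unitary_carrier by auto
  let ?p = "\<lambda>i. max (l i) 0" and ?q = "\<lambda>i. max (- l i) 0"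
  have "real_diag n l = real_diag n ?p - real_diag n ?q"
    by (rule eq_matI) (auto simp: real_diag_def max_def)
  then have "A = spectral n U ?p - spectral n U ?q"
    unfolding A spectral_def
    using mult_minus_distrib_mat[of U n n "real_diag n ?p" n "real_diag n ?q"]
      minus_mult_distrib_mat[of "U * real_diag n ?p" n n "U * real_diag n ?q" "adj U" n] Uc by simp
  moreover have "psd n (spectral n U ?p)" "psd n (spectral n U ?q)"
    using U by (auto intro: psd_spectral)
  moreover have "Re (mtrace (spectral n U ?p)) + Re (mtrace (spectral n U ?q)) \<le> trace_norm A"
    unfolding A trace_norm_spectral[OF U] mtrace_spectral[OF U] Re_complex_of_real sum.distrib[symmetric]
    by (intro sum_mono) auto
  ultimately show ?thesis unfolding psd_split_def by blast
qed

lemma psd_split_mono: "psd_split n A s \<Longrightarrow> s \<le> t \<Longrightarrow> psd_split n A t"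
  unfolding psd_split_def by force

lemma psd_split_add:
  assumes "psd_split n A s" "psd_split n B t"
  shows "psd_split n (A + B) (s + t)"
proof -
  obtain P Q where P: "psd n P" and Q: "psd n Q" and A: "A = P - Q"
    and s: "Re (mtrace P) + Re (mtrace Q) \<le> s"
    using assms(1) unfolding psd_split_def by blast
  obtain P' Q' where P': "psd n P'" and Q': "psd n Q'" and B: "B = P' - Q'"
    and t: "Re (mtrace P') + Re (mtrace Q') \<le> t"
    using assms(2) unfolding psd_split_def by blast
  note c = P[THEN psd_carrier] Q[THEN psd_carrier] P'[THEN psd_carrier] Q'[THEN psd_carrier]
  have "A + B = (P + P') - (Q + Q')" unfolding A B using c by (intro eq_matI) auto
  moreover have "Re (mtrace (P + P')) + Re (mtrace (Q + Q')) \<le> s + t"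
    using s t c by (simp add: mtrace_add[of _ n])
  ultimately show ?thesis unfolding psd_split_def using psd_add P P' Q Q' by blast
qed

text \<open>Transposition preserves positivity and trace. This carries bounds from one partial
  transpose to the other.\<close>

lemma psd_split_transpose:
  assumes "psd_split n A t" shows "psd_split n A\<^sup>T t"
proof -
  obtain P Q where P: "psd n P" and Q: "psd n Q" and A: "A = P - Q"
    and t: "Re (mtrace P) + Re (mtrace Q) \<le> t"
    using assms(1) unfolding psd_split_def by blast
  note c = P[THEN psd_carrier] Q[THEN psd_carrier]
  have "A\<^sup>T = P\<^sup>T - Q\<^sup>T" unfolding A using c by (intro eq_matI) auto
  moreover have "mtrace P\<^sup>T = mtrace P" "mtrace Q\<^sup>T = mtrace Q"
    using c by (auto simp: mtrace_def)
  ultimately show ?thesis unfolding psd_split_def using psd_transpose P Q t by metis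
qed

section \<open>Finite sums of matrices\<close>

lemma msum_carrier [simp]: "msum n I f \<in> carrier_mat n n"
  by (simp add: msum_def)

lemma msum_empty: "msum n {} f = 0\<^sub>m n n"
  by (rule eq_matI) (auto simp: msum_def)

lemma msum_insert:
  assumes "finite I" "i \<notin> I" "f i \<in> carrier_mat n n"
  shows "msum n (insert i I) f = f i + msum n I f"
  using assms by (intro eq_matI) (auto simp: msum_def)

lemma mtrace_msum:
  assumes "\<And>i. i \<in> I \<Longrightarrow> f i \<in> carrier_mat n n"
  shows "mtrace (msum n I f) = (\<Sum>i\<in>I. mtrace (f i))"
proof -
  have "mtrace (msum n I f) = (\<Sum>r<n. \<Sum>i\<in>I. f i $$ (r,r))"
    by (subst mtrace_sum[of _ n]) (auto simp: msum_def)
  also have "\<dots> = (\<Sum>i\<in>I. \<Sum>r<n. f i $$ (r,r))" by (rule sum.swap)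
  also have "\<dots> = (\<Sum>i\<in>I. mtrace (f i))"
    using assms by (intro sum.cong refl mtrace_sum[symmetric]) auto
  finally show ?thesis .
qed

lemma psd_split_carrier: "psd_split n A t \<Longrightarrow> A \<in> carrier_mat n n"
  unfolding psd_split_def using psd_carrier by auto

lemma psd_split_msum:
  assumes "finite I" "\<And>i. i \<in> I \<Longrightarrow> psd_split n (f i) (t i)"
  shows "psd_split n (msum n I f) (\<Sum>i\<in>I. t i)"
  using assms
proof (induction rule: finite_induct)
  case empty
  have "0\<^sub>m n n = 0\<^sub>m n n - (0\<^sub>m n n :: complex mat)" by (rule eq_matI) auto
  then show ?case unfolding msum_empty psd_split_def using psd_zero
    by (intro exI[of _ "0\<^sub>m n n"]) (auto simp: mtrace_def)
next
  case (insert i I)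
  moreover from insert have "f i \<in> carrier_mat n n" by (auto intro: psd_split_carrier)
  ultimately show ?case
    using psd_split_add[of n "f i" "t i" "msum n I f" "sum t I"] by (simp add: msum_insert)
qed

lemma psd_msum:
  assumes "finite I" "\<And>i. i \<in> I \<Longrightarrow> psd n (f i)" shows "psd n (msum n I f)"
  using assms
proof (induction rule: finite_induct)
  case empty
  then show ?case by (simp add: msum_empty psd_zero)
next
  case (insert i I)
  then show ?case by (simp add: msum_insert psd_carrier psd_add)
qed

subsection \<open>Channels and product indices\<close>

lemma product_index_less:
  fixes i a d n :: nat assumes "i < d" "a < n" shows "i * n + a < d * n"
proof -
  have "i * n + a < (i + 1) * n" using assms by simp
  also have "\<dots> \<le> d * n" using assms by (intro mult_right_mono) auto
  finally show ?thesis .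
qed

lemma product_index_split:
  fixes r d n :: nat assumes "r < d * n" shows "r div n < d" "r mod n < n"
proof -
  show "r div n < d" using assms by (simp add: less_mult_imp_div_less)
  show "r mod n < n" using assms by (cases "n = 0") auto
qed

lemma sum_product_blocks:
  fixes d n :: nat
  shows "(\<Sum>r<d * n. g r) = (\<Sum>i<d. \<Sum>a<n. g (i * n + a))"
proof -
  have "sum g {i * n..<i * n + n} = (\<Sum>a<n. g (i * n + a))" for i
    using sum.shift_bounds_nat_ivl[of g 0 "i * n" n] by (simp add: add.commute lessThan_atLeast0)
  then show ?thesis by (simp only: sum.nat_group[symmetric])
qed

lemma sum_product_index:
  fixes d n :: nat
  shows "(\<Sum>r<d * n. f (r div n) (r mod n)) = (\<Sum>i<d. \<Sum>a<n. f i a)"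
  unfolding sum_product_blocks by (intro sum.cong refl) simp

lemma CPT_minus:
  assumes "CPT d E" "A \<in> carrier_mat d d" "B \<in> carrier_mat d d"
  shows "E (A - B) = E A - E B"
proof -
  have "A - B = A + (- 1) \<cdot>\<^sub>m B" using assms by (intro eq_matI) auto
  then have "E (A - B) = E A + (- 1) \<cdot>\<^sub>m E B" using assms unfolding CPT_def by simp
  also have "\<dots> = E A - E B"
    using assms unfolding CPT_def by (intro eq_matI) (auto dest!: bspec[of _ _ B])
  finally show ?thesis .
qed

lemma CPT_carrier: "CPT d E \<Longrightarrow> A \<in> carrier_mat d d \<Longrightarrow> E A \<in> carrier_mat d d"
  by (simp add: CPT_def)

lemma CPT_ext_id_psd: "CPT d E \<Longrightarrow> psd (d * n) M \<Longrightarrow> psd (d * n) (ext_id d n E M)"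
  by (simp add: CPT_def)

lemma ext_id_minus:
  assumes "CPT d E" "M \<in> carrier_mat (d * n) (d * n)" "N \<in> carrier_mat (d * n) (d * n)"
  shows "ext_id d n E (M - N) = ext_id d n E M - ext_id d n E N"
proof (rule eq_matI)
  fix r c assume "r < dim_row (ext_id d n E M - ext_id d n E N)" "c < dim_col (ext_id d n E M - ext_id d n E N)"
  then have rc: "r < d * n" "c < d * n" by (auto simp: ext_id_def)
  note rc' = product_index_split[OF rc(1)] product_index_split[OF rc(2)]
  let ?B = "\<lambda>X. mat d d (\<lambda>(i,j). X $$ (i * n + r mod n, j * n + c mod n)) :: complex mat"
  have "?B (M - N) = ?B M - ?B N"
    using assms(2,3) rc' by (intro eq_matI) (auto simp: product_index_less)
  then have "E (?B (M - N)) = E (?B M) - E (?B N)" using CPT_minus[OF assms(1)] by simp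
  moreover have "E (?B M) \<in> carrier_mat d d" "E (?B N) \<in> carrier_mat d d"
    using CPT_carrier[OF assms(1)] by auto
  ultimately show "ext_id d n E (M - N) $$ (r,c) = (ext_id d n E M - ext_id d n E N) $$ (r,c)"
    using rc rc' by (simp add: ext_id_def)
qed (auto simp: ext_id_def)

text \<open>The trace sees only the blocks with equal ancilla indices, and \<open>E\<close>
  preserves the trace of each of them.\<close>

lemma mtrace_ext_id:
  assumes "CPT d E" "M \<in> carrier_mat (d * n) (d * n)"
  shows "mtrace (ext_id d n E M) = mtrace M"
proof -
  let ?B = "\<lambda>a. mat d d (\<lambda>(i,j). M $$ (i * n + a, j * n + a)) :: complex mat"
  have "mtrace (ext_id d n E M) = (\<Sum>r<d * n. E (?B (r mod n)) $$ (r div n, r div n))"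
    by (subst mtrace_sum[of _ "d * n"]) (auto simp: ext_id_def)
  also have "\<dots> = (\<Sum>i<d. \<Sum>a<n. E (?B a) $$ (i,i))" by (rule sum_product_index)
  also have "\<dots> = (\<Sum>a<n. \<Sum>i<d. E (?B a) $$ (i,i))" by (rule sum.swap)
  also have "\<dots> = (\<Sum>a<n. mtrace (E (?B a)))"
    by (intro sum.cong refl mtrace_sum[symmetric] CPT_carrier[OF assms(1)]) auto
  also have "\<dots> = (\<Sum>a<n. mtrace (?B a))" using assms(1) by (simp add: CPT_def)
  also have "\<dots> = (\<Sum>a<n. \<Sum>i<d. M $$ (i * n + a, i * n + a))"
    by (intro sum.cong refl) (simp add: mtrace_def)
  also have "\<dots> = (\<Sum>i<d. \<Sum>a<n. M $$ (i * n + a, i * n + a))" by (rule sum.swap)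
  also have "\<dots> = mtrace M"
    unfolding mtrace_sum[OF assms(2)] sum_product_blocks ..
  finally show ?thesis .
qed

text \<open>Contractivity of channels on Hermitian operators: complete positivity keeps both parts
  positive, trace preservation keeps the bound.\<close>

lemma psd_split_ext_id:
  assumes "CPT d E" "psd_split (d * n) A t"
  shows "psd_split (d * n) (ext_id d n E A) t"
proof -
  obtain P Q where P: "psd (d * n) P" and Q: "psd (d * n) Q" and A: "A = P - Q"
    and t: "Re (mtrace P) + Re (mtrace Q) \<le> t"
    using assms(2) unfolding psd_split_def by blast
  note c = P[THEN psd_carrier] Q[THEN psd_carrier]
  have "ext_id d n E A = ext_id d n E P - ext_id d n E Q"
    unfolding A by (rule ext_id_minus[OF assms(1) c])
  moreover have "mtrace (ext_id d n E P) = mtrace P" "mtrace (ext_id d n E Q) = mtrace Q"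
    using mtrace_ext_id[OF assms(1)] c by auto
  ultimately show ?thesis unfolding psd_split_def
    using CPT_ext_id_psd[OF assms(1) P] CPT_ext_id_psd[OF assms(1) Q] t by metis
qed

section \<open>Kronecker products\<close>

definition kron :: "nat \<Rightarrow> complex mat \<Rightarrow> complex mat \<Rightarrow> complex mat" where
  "kron d A B = mat (d * d) (d * d) (\<lambda>(r,c). A $$ (r div d, c div d) * B $$ (r mod d, c mod d))"

lemma kron_carrier [simp]: "kron d A B \<in> carrier_mat (d * d) (d * d)"
  by (simp add: kron_def)

lemma kron_mult:
  assumes "A \<in> carrier_mat d d" "B \<in> carrier_mat d d" "A' \<in> carrier_mat d d" "B' \<in> carrier_mat d d"
  shows "kron d A B * kron d A' B' = kron d (A * A') (B * B')"
proof (rule eq_matI)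
  fix r c assume "r < dim_row (kron d (A * A') (B * B'))" "c < dim_col (kron d (A * A') (B * B'))"
  then have rc: "r < d * d" "c < d * d" by (auto simp: kron_def)
  note rc' = product_index_split[OF rc(1)] product_index_split[OF rc(2)]
  have "(kron d A B * kron d A' B') $$ (r,c) = (\<Sum>s<d * d. kron d A B $$ (r,s) * kron d A' B' $$ (s,c))"
    using rc by (intro mult_mat_entry) auto
  also have "\<dots> = (\<Sum>s<d * d. (A $$ (r div d, s div d) * A' $$ (s div d, c div d))
      * (B $$ (r mod d, s mod d) * B' $$ (s mod d, c mod d)))"
    using rc by (intro sum.cong refl) (simp add: kron_def)
  also have "\<dots> = (\<Sum>k<d. \<Sum>b<d. (A $$ (r div d, k) * A' $$ (k, c div d)) * (B $$ (r mod d, b) * B' $$ (b, c mod d)))"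
    by (rule sum_product_index)
  also have "\<dots> = (A * A') $$ (r div d, c div d) * (B * B') $$ (r mod d, c mod d)"
    unfolding mult_mat_entry[OF assms(1,3) rc'(1,3)] mult_mat_entry[OF assms(2,4) rc'(2,4)]
    by (simp add: sum_product)
  also have "\<dots> = kron d (A * A') (B * B') $$ (r,c)" using rc by (simp add: kron_def)
  finally show "(kron d A B * kron d A' B') $$ (r,c) = kron d (A * A') (B * B') $$ (r,c)" .
qed (auto simp: kron_def)

lemma adj_kron:
  assumes "A \<in> carrier_mat d d" "B \<in> carrier_mat d d"
  shows "adj (kron d A B) = kron d (adj A) (adj B)"
  using assms by (intro eq_matI) (auto simp: kron_def adj_def product_index_split)

lemma mtrace_kron:
  assumes "A \<in> carrier_mat d d" "B \<in> carrier_mat d d"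
  shows "mtrace (kron d A B) = mtrace A * mtrace B"
proof -
  have "mtrace (kron d A B) = (\<Sum>r<d * d. A $$ (r div d, r div d) * B $$ (r mod d, r mod d))"
    by (subst mtrace_sum[of _ "d * d"]) (auto simp: kron_def)
  also have "\<dots> = (\<Sum>i<d. \<Sum>a<d. A $$ (i,i) * B $$ (a,a))" by (rule sum_product_index)
  finally show ?thesis using assms by (simp add: mtrace_sum[of _ d] sum_product)
qed

text \<open>The Kronecker product of the two square roots is Hermitian and squares to
  \<open>kron d A B\<close>, which is therefore a Gram matrix.\<close>

lemma psd_kron:
  assumes "psd d A" "psd d B" shows "psd (d * d) (kron d A B)"
proof -
  obtain X where X: "psd d X" "X * X = A" using psd_sqrt_exists[OF assms(1)] .
  obtain Y where Y: "psd d Y" "Y * Y = B" using psd_sqrt_exists[OF assms(2)] .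
  have c: "X \<in> carrier_mat d d" "Y \<in> carrier_mat d d" using X Y psd_carrier by auto
  have "kron d A B = kron d X Y * adj (kron d X Y)"
    using c X Y by (simp add: adj_kron kron_mult psd_hermitian)
  then show ?thesis using psd_gram[OF kron_carrier, of d X Y] by simp
qed

subsection \<open>Superadditivity of the purity gap\<close>

text \<open>For Hermitian \<open>G\<close> this is the sum of products of eigenvalues over ordered
  pairs of distinct indices. At unit trace it is one minus the purity, so
  \<open>sqrt (2 * purity_gap G)\<close> is the root occurring in \<open>F_Delta\<close>.\<close>

definition purity_gap :: "complex mat \<Rightarrow> real" where
  "purity_gap G = (Re (mtrace G))\<^sup>2 - Re (mtrace (G * G))"

lemma offdiag_sum:
  fixes f :: "nat \<Rightarrow> real"
  shows "(\<Sum>i<n. f i)\<^sup>2 - (\<Sum>i<n. (f i)\<^sup>2) = (\<Sum>(i,j)\<in>{..<n} \<times> {..<n} - (\<lambda>i. (i,i)) ` {..<n}. f i * f j)"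
proof -
  have "(\<Sum>i<n. f i)\<^sup>2 = (\<Sum>(i,j)\<in>{..<n} \<times> {..<n}. f i * f j)"
    by (simp add: power2_eq_square sum_product sum.cartesian_product)
  also have "\<dots> = (\<Sum>(i,j)\<in>{..<n} \<times> {..<n} - (\<lambda>i. (i,i)) ` {..<n}. f i * f j)
      + (\<Sum>(i,j)\<in>(\<lambda>i. (i,i)) ` {..<n}. f i * f j)"
    by (rule sum.subset_diff) auto
  also have "(\<Sum>(i,j)\<in>(\<lambda>i. (i,i)) ` {..<n}. f i * f j) = (\<Sum>i<n. (f i)\<^sup>2)"
    by (subst sum.reindex) (auto simp: inj_on_def power2_eq_square)
  finally show ?thesis by simp
qed

text \<open>Cauchy-Schwarz against the constant 1 over ordered pairs of distinct indices. The
  \<open>l i\<close> play the role of singular values of \<open>M\<close>, their squares that of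
  eigenvalues of \<open>M * adj M\<close>.\<close>

lemma sum_sq_le_sum_of_squares:
  fixes l :: "nat \<Rightarrow> real"
  assumes "\<And>i. i < n \<Longrightarrow> 0 \<le> l i"
  shows "(\<Sum>i<n. l i)\<^sup>2 \<le> (\<Sum>i<n. (l i)\<^sup>2)
    + sqrt (real n * (real n - 1)) * sqrt ((\<Sum>i<n. (l i)\<^sup>2)\<^sup>2 - (\<Sum>i<n. ((l i)\<^sup>2)\<^sup>2))"
proof -
  let ?S = "{..<n} \<times> {..<n} - (\<lambda>i. (i,i)) ` {..<n}"
  \<comment> \<open>The number of pairs comes from the off-diagonal identity applied to the constant
    1.\<close>
  have card: "real n * (real n - 1) = real (card ?S)"
    using offdiag_sum[of "\<lambda>_. 1" n] by (simp add: power2_eq_square algebra_simps split_def)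
  have "(\<Sum>i<n. l i)\<^sup>2 - (\<Sum>i<n. (l i)\<^sup>2) = (\<Sum>p\<in>?S. \<bar>1\<bar> * \<bar>l (fst p) * l (snd p)\<bar>)"
    unfolding offdiag_sum split_def using assms by (intro sum.cong refl) auto
  also have "\<dots> \<le> L2_set (\<lambda>_. 1) ?S * L2_set (\<lambda>p. l (fst p) * l (snd p)) ?S"
    by (rule L2_set_mult_ineq)
  also have "L2_set (\<lambda>_. 1) ?S = sqrt (real n * (real n - 1))"
    unfolding card by (simp add: L2_set_def)
  also have "L2_set (\<lambda>p. l (fst p) * l (snd p)) ?S = sqrt ((\<Sum>i<n. (l i)\<^sup>2)\<^sup>2 - (\<Sum>i<n. ((l i)\<^sup>2)\<^sup>2))"
    unfolding offdiag_sum L2_set_def split_def by (simp add: power_mult_distrib)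
  finally show ?thesis by simp
qed

text \<open>Meant for \<open>R\<close> the positive root of \<open>M * adj M\<close> or
  \<open>adj M * M\<close>: it controls the trace of the root by trace and purity gap of
  \<open>R * R\<close>.\<close>

lemma psd_trace_sq_le:
  assumes "psd n R"
  shows "(Re (mtrace R))\<^sup>2 \<le> Re (mtrace (R * R))
    + sqrt (real n * (real n - 1)) * sqrt (purity_gap (R * R))"
proof -
  obtain U l where U: "unitary n U" "R = spectral n U l" "\<And>i. i < n \<Longrightarrow> 0 \<le> l i"
    using psd_spectral_decomposition[OF assms] by blast
  show ?thesis
    using sum_sq_le_sum_of_squares[of n l] U(3)
    unfolding U(2) purity_gap_def spectral_mult[OF U(1)] mtrace_spectral[OF U(1)]
    by (simp add: power2_eq_square)
qed

lemma purity_gap_nonneg: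
  assumes "psd n G" shows "0 \<le> purity_gap G"
proof -
  obtain U l where U: "unitary n U" "G = spectral n U l" "\<And>i. i < n \<Longrightarrow> 0 \<le> l i"
    using psd_spectral_decomposition[OF assms] by blast
  have "0 \<le> (\<Sum>i<n. l i)\<^sup>2 - (\<Sum>i<n. (l i)\<^sup>2)"
    unfolding offdiag_sum using U(3) by (intro sum_nonneg) auto
  then show ?thesis
    unfolding U(2) purity_gap_def spectral_mult[OF U(1)] mtrace_spectral[OF U(1)]
    by (simp add: power2_eq_square)
qed

lemma hermitian_entry: "A \<in> carrier_mat n n \<Longrightarrow> adj A = A \<Longrightarrow> i < n \<Longrightarrow> j < n \<Longrightarrow> A $$ (j,i) = cnj (A $$ (i,j))"
  by (metis adj_entry carrier_matD)

lemma hermitian_trace_square: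
  assumes "A \<in> carrier_mat n n" "adj A = A"
  shows "Re (mtrace (A * A)) = (\<Sum>p\<in>{..<n} \<times> {..<n}. (cmod (A $$ p))\<^sup>2)"
proof -
  have "Re (A $$ (i,j) * A $$ (j,i)) = (cmod (A $$ (i,j)))\<^sup>2" if "i < n" "j < n" for i j
    using hermitian_entry[OF assms that] by (simp add: cmod_power2) (simp add: power2_eq_square)
  then show ?thesis
    unfolding mtrace_mult[OF assms(1,1)] Re_sum
    by (subst sum.cartesian_product) (auto intro!: sum.cong)
qed

text \<open>Matrices are read as vectors indexed by pairs, with the Hilbert-Schmidt inner
  product.\<close>

lemma hermitian_trace_cauchy_schwarz:
  assumes "A \<in> carrier_mat n n" "adj A = A" "B \<in> carrier_mat n n" "adj B = B"
  shows "Re (mtrace (A * B)) \<le> sqrt (Re (mtrace (A * A))) * sqrt (Re (mtrace (B * B)))"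
proof -
  let ?S = "{..<n} \<times> {..<n}"
  have "Re (A $$ (i,j) * B $$ (j,i)) \<le> \<bar>cmod (A $$ (i,j))\<bar> * \<bar>cmod (B $$ (i,j))\<bar>" if "i < n" "j < n" for i j
    using complex_Re_le_cmod[of "A $$ (i,j) * B $$ (j,i)"] hermitian_entry[OF assms(3,4) that]
    by (simp add: norm_mult)
  then have "Re (mtrace (A * B)) \<le> (\<Sum>p\<in>?S. \<bar>cmod (A $$ p)\<bar> * \<bar>cmod (B $$ p)\<bar>)"
    unfolding mtrace_mult[OF assms(1,3)] Re_sum
    by (subst sum.cartesian_product) (auto intro!: sum_mono)
  also have "\<dots> \<le> L2_set (\<lambda>p. cmod (A $$ p)) ?S * L2_set (\<lambda>p. cmod (B $$ p)) ?S"
    by (rule L2_set_mult_ineq)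
  finally show ?thesis
    unfolding hermitian_trace_square[OF assms(1,2)] hermitian_trace_square[OF assms(3,4)] L2_set_def .
qed

text \<open>The reverse triangle inequality of Lorentzian geometry: \<open>a\<close>,
  \<open>b\<close> are time components, \<open>x\<close>, \<open>y\<close> spatial lengths, and
  \<open>p\<close> the spatial inner product, needed only up to its Cauchy-Schwarz bound.\<close>

lemma reverse_cauchy_schwarz_sqrt:
  fixes a b x y p :: real
  assumes "0 \<le> x" "x \<le> a" "0 \<le> y" "y \<le> b" "p \<le> x * y"
  shows "sqrt (a\<^sup>2 - x\<^sup>2) + sqrt (b\<^sup>2 - y\<^sup>2) \<le> sqrt ((a + b)\<^sup>2 - (x\<^sup>2 + 2 * p + y\<^sup>2))"
proof (rule real_le_rsqrt)
  have nn: "0 \<le> a\<^sup>2 - x\<^sup>2" "0 \<le> b\<^sup>2 - y\<^sup>2" using assms by (auto intro!: power_mono)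
  \<comment> \<open>This square is exactly the difference of the two sides of the next
    inequality.\<close>
  have "(a * y - b * x)\<^sup>2 \<ge> 0" by simp
  then have "(a\<^sup>2 - x\<^sup>2) * (b\<^sup>2 - y\<^sup>2) \<le> (a * b - x * y)\<^sup>2"
    by (simp add: power2_eq_square algebra_simps)
  moreover have "x * y \<le> a * b" using assms by (intro mult_mono) auto
  ultimately have "sqrt ((a\<^sup>2 - x\<^sup>2) * (b\<^sup>2 - y\<^sup>2)) \<le> a * b - x * y"
    by (intro real_le_lsqrt) auto
  then have "sqrt (a\<^sup>2 - x\<^sup>2) * sqrt (b\<^sup>2 - y\<^sup>2) \<le> a * b - p"
    using assms(5) by (simp add: real_sqrt_mult)
  then show "(sqrt (a\<^sup>2 - x\<^sup>2) + sqrt (b\<^sup>2 - y\<^sup>2))\<^sup>2 \<le> (a + b)\<^sup>2 - (x\<^sup>2 + 2 * p + y\<^sup>2)"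
    using nn by (simp add: power2_sum)
qed

text \<open>A positive semidefinite matrix lies in a light cone, with its trace as time component
  and its Hilbert-Schmidt norm \<open>x\<close> or \<open>y\<close> as spatial length;
  \<open>purity_gap\<close> is the squared Lorentzian length.\<close>

lemma sqrt_purity_gap_superadditive:
  assumes G: "psd n G" and H: "psd n H"
  shows "sqrt (purity_gap G) + sqrt (purity_gap H) \<le> sqrt (purity_gap (G + H))"
proof -
  note c = G[THEN psd_carrier] H[THEN psd_carrier]
  note h = G[THEN psd_hermitian] H[THEN psd_hermitian]
  define x where "x = sqrt (Re (mtrace (G * G)))"
  define y where "y = sqrt (Re (mtrace (H * H)))"
  have x2: "x\<^sup>2 = Re (mtrace (G * G))" "0 \<le> x"
    unfolding x_def using hermitian_trace_square[OF c(1) h(1)] by (auto simp: sum_nonneg)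
  have y2: "y\<^sup>2 = Re (mtrace (H * H))" "0 \<le> y"
    unfolding y_def using hermitian_trace_square[OF c(2) h(2)] by (auto simp: sum_nonneg)
  have tr: "0 \<le> Re (mtrace G)" "0 \<le> Re (mtrace H)"
    using psd_trace_nonneg[OF G] psd_trace_nonneg[OF H] by (auto simp: less_eq_complex_def)
  have le: "x \<le> Re (mtrace G)" "y \<le> Re (mtrace H)"
    using purity_gap_nonneg[OF G] purity_gap_nonneg[OF H] x2 y2 tr
    unfolding purity_gap_def by (auto intro: power2_le_imp_le)
  have "(G + H) * (G + H) = (G * G + G * H) + (H * G + H * H)"
    using c by (simp add: add_mult_distrib_mat[of _ n n _ _ n] mult_add_distrib_mat[of _ n n _ n])
      (intro eq_matI, auto)
  then have "mtrace ((G + H) * (G + H)) = mtrace (G * G) + 2 * mtrace (G * H) + mtrace (H * H)"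
    using c mtrace_mult_commute[OF c] by (simp add: mtrace_add[of _ n])
  then have "purity_gap (G + H)
      = (Re (mtrace G) + Re (mtrace H))\<^sup>2 - (x\<^sup>2 + 2 * Re (mtrace (G * H)) + y\<^sup>2)"
    using c by (simp add: purity_gap_def mtrace_add[of _ n] x2 y2)
  moreover have "purity_gap G = (Re (mtrace G))\<^sup>2 - x\<^sup>2" "purity_gap H = (Re (mtrace H))\<^sup>2 - y\<^sup>2"
    by (simp_all add: purity_gap_def x2 y2)
  moreover have "Re (mtrace (G * H)) \<le> x * y"
    unfolding x_def y_def using hermitian_trace_cauchy_schwarz[OF c(1) h(1) c(2) h(2)] .
  ultimately show ?thesis
    using reverse_cauchy_schwarz_sqrt[OF x2(2) le(1) y2(2) le(2)] by simp
qed

lemma sqrt_purity_gap_msum: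
  assumes "finite J" "\<And>j. j \<in> J \<Longrightarrow> psd n (G j)"
  shows "(\<Sum>j\<in>J. sqrt (purity_gap (G j))) \<le> sqrt (purity_gap (msum n J G))"
  using assms
proof (induction rule: finite_induct)
  case empty
  then show ?case by (simp add: msum_empty purity_gap_def mtrace_def)
next
  case (insert j J)
  then have "psd n (G j)" "psd n (msum n J G)" by (auto intro: psd_msum)
  from sqrt_purity_gap_superadditive[OF this] insert psd_carrier[OF this(1)]
  show ?case by (simp add: msum_insert)
qed

subsection \<open>Pure states and partial transposition\<close>

text \<open>The matrix \<open>M\<close> stands for the vector with amplitude \<open>M $$ (i,a)\<close> at \<open>|i>\<^sub>S |a>\<^sub>A\<close>.\<close>

definition vec_proj :: "nat \<Rightarrow> complex mat \<Rightarrow> complex mat" where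
  "vec_proj d M = mat (d * d) (d * d) (\<lambda>(r,c). M $$ (r div d, r mod d) * cnj (M $$ (c div d, c mod d)))"

text \<open>The operator on S left after fixing the ancilla indices of row and column;
  \<open>ext_id d d E\<close> feeds \<open>E\<close> precisely these blocks.\<close>

definition ancilla_block :: "nat \<Rightarrow> complex mat \<Rightarrow> nat \<Rightarrow> nat \<Rightarrow> complex mat" where
  "ancilla_block d M a b = mat d d (\<lambda>(i,j). M $$ (i * d + a, j * d + b))"

lemma vec_proj_carrier [simp]: "vec_proj d M \<in> carrier_mat (d * d) (d * d)"
  by (simp add: vec_proj_def)

lemma vec_proj_entry [simp]:
  assumes "i < d" "a < d" "j < d" "b < d"
  shows "vec_proj d M $$ (i * d + a, j * d + b) = M $$ (i,a) * cnj (M $$ (j,b))"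
  using assms by (simp add: vec_proj_def product_index_less)

lemma ptrans_A_carrier [simp]: "ptrans_A d M \<in> carrier_mat (d * d) (d * d)"
  by (simp add: ptrans_A_def)

lemma adj_ptrans_A_vec_proj: "adj (ptrans_A d (vec_proj d M)) = ptrans_A d (vec_proj d M)"
  by (rule eq_matI) (auto simp: adj_def ptrans_A_def product_index_split intro: mult.commute)

text \<open>At row (i,a) and column (j,b) the partial transpose has the entry
  \<open>M $$ (i,b) * cnj (M $$ (j,a))\<close>. In the product the intermediate indices
  \<open>j\<close> and \<open>b\<close> therefore separate into two independent sums.\<close>

lemma ptrans_A_vec_proj_square:
  assumes M: "M \<in> carrier_mat d d"
  shows "ptrans_A d (vec_proj d M) * ptrans_A d (vec_proj d M) = kron d (M * adj M) (adj M * M)"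
    (is "?A * ?A = _")
proof (rule eq_matI)
  fix r c assume "r < dim_row (kron d (M * adj M) (adj M * M))" "c < dim_col (kron d (M * adj M) (adj M * M))"
  then have rc: "r < d * d" "c < d * d" by (auto simp: kron_def)
  note rc' = product_index_split[OF rc(1)] product_index_split[OF rc(2)]
  have "(?A * ?A) $$ (r,c) = (\<Sum>s<d * d. ?A $$ (r,s) * ?A $$ (s,c))"
    using rc by (intro mult_mat_entry) auto
  also have "\<dots> = (\<Sum>s<d * d. (cnj (M $$ (s div d, r mod d)) * M $$ (s div d, c mod d))
      * (M $$ (r div d, s mod d) * cnj (M $$ (c div d, s mod d))))"
    using rc rc' by (intro sum.cong refl) (simp add: ptrans_A_def product_index_split)
  also have "\<dots> = (\<Sum>j<d. \<Sum>b<d. (cnj (M $$ (j, r mod d)) * M $$ (j, c mod d))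
      * (M $$ (r div d, b) * cnj (M $$ (c div d, b))))"
    by (rule sum_product_index)
  also have "\<dots> = (\<Sum>j<d. cnj (M $$ (j, r mod d)) * M $$ (j, c mod d))
      * (\<Sum>b<d. M $$ (r div d, b) * cnj (M $$ (c div d, b)))"
    by (simp add: sum_product)
  also have "(\<Sum>j<d. cnj (M $$ (j, r mod d)) * M $$ (j, c mod d)) = (adj M * M) $$ (r mod d, c mod d)"
    using M rc' by (subst mult_mat_entry[of _ d d _ d]) auto
  also have "(\<Sum>b<d. M $$ (r div d, b) * cnj (M $$ (c div d, b))) = (M * adj M) $$ (r div d, c div d)"
    using M rc' by (subst mult_mat_entry[of _ d d _ d]) auto
  finally show "(?A * ?A) $$ (r,c) = kron d (M * adj M) (adj M * M) $$ (r,c)"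
    using rc by (simp add: kron_def)
qed (auto simp: kron_def ptrans_A_def)

text \<open>Both facts follow from cyclicity of the trace. They let one bound on a pure component
  serve both of its marginals.\<close>

lemma purity_gap_adj_mult:
  assumes M: "M \<in> carrier_mat d d"
  shows "mtrace (adj M * M) = mtrace (M * adj M)" "purity_gap (adj M * M) = purity_gap (M * adj M)"
proof -
  show 1: "mtrace (adj M * M) = mtrace (M * adj M)"
    using M by (intro mtrace_mult_commute[of _ d d]) auto
  have "mtrace ((adj M * M) * (adj M * M)) = mtrace (adj M * (M * adj M * M))"
    using M by (simp add: assoc_mult_mat[of _ d d _ d _ d])
  also have "\<dots> = mtrace ((M * adj M * M) * adj M)"
    using M by (intro mtrace_mult_commute[of _ d d]) auto
  also have "\<dots> = mtrace ((M * adj M) * (M * adj M))"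
    using M by (simp add: assoc_mult_mat[of _ d d _ d _ d])
  finally show "purity_gap (adj M * M) = purity_gap (M * adj M)"
    using 1 by (simp add: purity_gap_def)
qed

lemma psd_split_ptrans_A_vec_proj:
  assumes M: "M \<in> carrier_mat d d"
  shows "psd_split (d * d) (ptrans_A d (vec_proj d M))
    (Re (mtrace (M * adj M)) + sqrt (real d * (real d - 1)) * sqrt (purity_gap (M * adj M)))"
    (is "psd_split _ ?A ?t")
proof -
  have "psd d (M * adj M)" using psd_gram[OF M] .
  \<comment> \<open>\<open>R\<close> is the modulus of \<open>adj M\<close> and \<open>S\<close>
    that of \<open>M\<close>, so \<open>kron d R S\<close> is the positive root of the squared
    partial transpose.\<close>
  then obtain R where R: "psd d R" "R * R = M * adj M" using psd_sqrt_exists by blast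
  have "psd d (adj M * M)" using psd_gram[of "adj M" d d] M by simp
  then obtain S where S: "psd d S" "S * S = adj M * M" using psd_sqrt_exists by blast
  note c = R(1)[THEN psd_carrier] S(1)[THEN psd_carrier]
  have "trace_norm ?A = Re (mtrace (kron d R S))"
  proof (rule trace_norm_eqI[where m = "d * d" and n = "d * d"])
    show "kron d R S * kron d R S = adj ?A * ?A"
      using c M by (simp add: adj_ptrans_A_vec_proj ptrans_A_vec_proj_square kron_mult R S)
  qed (auto intro: psd_kron R S)
  also have "\<dots> = Re (mtrace R) * Re (mtrace S)"
    using psd_trace_nonneg[OF R(1)] c by (simp add: mtrace_kron less_eq_complex_def)
  \<comment> \<open>The arithmetic-geometric mean inequality replaces a proof that the two traces
    agree: the squares of both are bounded by the same quantity \<open>?t\<close>.\<close>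
  also have "\<dots> \<le> ((Re (mtrace R))\<^sup>2 + (Re (mtrace S))\<^sup>2) / 2"
    using sum_squares_bound[of "Re (mtrace R)" "Re (mtrace S)"] by simp
  also have "\<dots> \<le> ?t"
    using psd_trace_sq_le[OF R(1)] psd_trace_sq_le[OF S(1)] purity_gap_adj_mult[OF M]
    unfolding R S by simp
  finally show ?thesis
    using psd_split_mono[OF psd_split_hermitian[OF ptrans_A_carrier adj_ptrans_A_vec_proj]] by blast
qed

lemma ptrace_A_vec_proj:
  assumes "M \<in> carrier_mat d d" shows "ptrace_A d (vec_proj d M) = M * adj M"
proof (rule eq_matI)
  fix i j assume "i < dim_row (M * adj M)" "j < dim_col (M * adj M)"
  then have "i < d" "j < d" using assms by (auto simp: adj_def)
  then show "ptrace_A d (vec_proj d M) $$ (i,j) = (M * adj M) $$ (i,j)"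
    using assms by (subst mult_mat_entry[of _ d d _ d]) (auto simp: ptrace_A_def)
qed (use assms in \<open>auto simp: ptrace_A_def adj_def\<close>)

text \<open>The ancilla index is the column index of \<open>M\<close> and the conjugate sits on the
  second factor, whence the transpose. The purity gap does not see it.\<close>

lemma ptrace_S_vec_proj:
  assumes "M \<in> carrier_mat d d" shows "ptrace_S d (vec_proj d M) = (adj M * M)\<^sup>T"
proof (rule eq_matI)
  fix a b assume "a < dim_row (adj M * M)\<^sup>T" "b < dim_col (adj M * M)\<^sup>T"
  then have ab: "a < d" "b < d" using assms by (auto simp: adj_def)
  have "(adj M * M)\<^sup>T $$ (a,b) = (adj M * M) $$ (b,a)"
    using ab assms by (intro index_transpose_mat) (auto simp: adj_def)
  also have "\<dots> = ptrace_S d (vec_proj d M) $$ (a,b)"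
    using ab assms by (subst mult_mat_entry[of _ d d _ d]) (auto simp: ptrace_S_def mult.commute)
  finally show "ptrace_S d (vec_proj d M) $$ (a,b) = (adj M * M)\<^sup>T $$ (a,b)" ..
qed (use assms in \<open>auto simp: ptrace_S_def adj_def\<close>)

lemma purity_gap_transpose:
  assumes "G \<in> carrier_mat n n" shows "purity_gap G\<^sup>T = purity_gap G"
proof -
  have "mtrace (G\<^sup>T * G\<^sup>T) = mtrace (G * G)"
    using assms transpose_mult[of G n n G n, symmetric] by (auto simp: mtrace_def)
  moreover have "mtrace G\<^sup>T = mtrace G" using assms by (auto simp: mtrace_def)
  ultimately show ?thesis by (simp add: purity_gap_def)
qed

section \<open>Partial traces and partial transposes of sums and of channel outputs\<close>

lemma msum_cong: "(\<And>i. i \<in> I \<Longrightarrow> f i = g i) \<Longrightarrow> msum n I f = msum n I g"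
  by (simp add: msum_def cong: sum.cong)

lemma ptrace_A_msum: "ptrace_A d (msum (d * d) J f) = msum d J (\<lambda>j. ptrace_A d (f j))"
proof (rule eq_matI)
  fix i j assume "i < dim_row (msum d J (\<lambda>j. ptrace_A d (f j)))" "j < dim_col (msum d J (\<lambda>j. ptrace_A d (f j)))"
  then have "i < d" "j < d" by (auto simp: msum_def)
  then show "ptrace_A d (msum (d * d) J f) $$ (i,j) = msum d J (\<lambda>j. ptrace_A d (f j)) $$ (i,j)"
    by (simp add: ptrace_A_def msum_def product_index_less sum.swap[of _ J])
qed (auto simp: ptrace_A_def msum_def)

lemma ptrace_S_msum: "ptrace_S d (msum (d * d) J f) = msum d J (\<lambda>j. ptrace_S d (f j))"
proof (rule eq_matI)
  fix i j assume "i < dim_row (msum d J (\<lambda>j. ptrace_S d (f j)))" "j < dim_col (msum d J (\<lambda>j. ptrace_S d (f j)))"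
  then have "i < d" "j < d" by (auto simp: msum_def)
  then show "ptrace_S d (msum (d * d) J f) $$ (i,j) = msum d J (\<lambda>j. ptrace_S d (f j)) $$ (i,j)"
    by (simp add: ptrace_S_def msum_def product_index_less sum.swap[of _ J])
qed (auto simp: ptrace_S_def msum_def)

lemma mtrace_ptrace_A:
  assumes "M \<in> carrier_mat (d * d) (d * d)" shows "mtrace (ptrace_A d M) = mtrace M"
  unfolding mtrace_sum[OF assms] sum_product_blocks
  by (subst mtrace_sum[of _ d]) (auto simp: ptrace_A_def)

lemma mtrace_ptrace_S:
  assumes "M \<in> carrier_mat (d * d) (d * d)" shows "mtrace (ptrace_S d M) = mtrace M"
proof -
  have "mtrace (ptrace_S d M) = (\<Sum>a<d. \<Sum>i<d. M $$ (i * d + a, i * d + a))"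
    by (subst mtrace_sum[of _ d]) (auto simp: ptrace_S_def)
  also have "\<dots> = (\<Sum>i<d. \<Sum>a<d. M $$ (i * d + a, i * d + a))" by (rule sum.swap)
  finally show ?thesis unfolding mtrace_sum[OF assms] sum_product_blocks .
qed

lemma ptrans_A_msum: "ptrans_A d (msum (d * d) J f) = msum (d * d) J (\<lambda>j. ptrans_A d (f j))"
  by (rule eq_matI) (auto simp: ptrans_A_def msum_def product_index_less product_index_split)

text \<open>Transposing the ancilla only exchanges the blocks (a,b) and (b,a), while the map acts
  inside each block.\<close>

lemma ptrans_A_ext_id: "ptrans_A d (ext_id d d E M) = ext_id d d E (ptrans_A d M)"
proof (rule eq_matI)
  fix r c assume "r < dim_row (ext_id d d E (ptrans_A d M))" "c < dim_col (ext_id d d E (ptrans_A d M))"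
  then have rc: "r < d * d" "c < d * d" by (auto simp: ext_id_def)
  note rc' = product_index_split[OF rc(1)] product_index_split[OF rc(2)]
  have "mat d d (\<lambda>(i,j). ptrans_A d M $$ (i * d + r mod d, j * d + c mod d))
      = mat d d (\<lambda>(i,j). M $$ (i * d + c mod d, j * d + r mod d))"
    using rc' by (intro eq_matI) (auto simp: ptrans_A_def product_index_less)
  then show "ptrans_A d (ext_id d d E M) $$ (r,c) = ext_id d d E (ptrans_A d M) $$ (r,c)"
    using rc rc' by (simp add: ptrans_A_def ext_id_def product_index_less)
qed (auto simp: ptrans_A_def ext_id_def)

text \<open>Reduces every estimate for \<open>T_S\<close> to one for \<open>T_A\<close>.\<close>

lemma ptrans_S_eq_transpose: "ptrans_S d M = (ptrans_A d M)\<^sup>T"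
  by (rule eq_matI) (auto simp: ptrans_S_def ptrans_A_def)

text \<open>The columns of the square root of \<open>\<rho>\<close>, reshaped to \<open>d\<close> by
  \<open>d\<close> matrices, are the unnormalised pure components, and an operator \<open>K\<close>
  on S multiplies them from the left. The form by blocks, with \<open>K\<close> included, matches
  what the Kraus maps act on inside \<open>ext_id\<close>.\<close>

lemma psd_vec_proj_decomposition:
  assumes "psd (d * d) \<rho>"
  obtains N :: "nat \<Rightarrow> complex mat" where "\<And>k. N k \<in> carrier_mat d d"
    "\<And>(K :: complex mat) a b. K \<in> carrier_mat d d \<Longrightarrow> a < d \<Longrightarrow> b < d \<Longrightarrow>
      K * ancilla_block d \<rho> a b * adj K
        = ancilla_block d (msum (d * d) {..<d * d} (\<lambda>k. vec_proj d (K * N k))) a b"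
proof -
  obtain B where B: "psd (d * d) B" "B * B = \<rho>" using psd_sqrt_exists[OF assms] .
  have Bc: "B \<in> carrier_mat (d * d) (d * d)" using B psd_carrier by auto
  have \<rho>: "\<rho> = B * adj B" using B psd_hermitian by simp
  \<comment> \<open>Both regroup the entries of \<open>B\<close>: \<open>N k\<close> fixes the
    column \<open>k\<close>, while \<open>C a\<close> fixes the ancilla part of the row, so that the
    block (a,b) of \<open>\<rho>\<close> factors as \<open>C a * adj (C b)\<close>.\<close>
  define N where "N k = mat d d (\<lambda>(i,a). B $$ (i * d + a, k))" for k
  define C where "C a = mat d (d * d) (\<lambda>(i,k). B $$ (i * d + a, k))" for a
  have Nc: "N k \<in> carrier_mat d d" for k by (simp add: N_def)
  have Cc: "C a \<in> carrier_mat d (d * d)" for a by (simp add: C_def)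
  show thesis
  proof (rule that[OF Nc])
    fix K :: "complex mat" and a b assume K: "K \<in> carrier_mat d d" and ab: "a < d" "b < d"
    have blk: "ancilla_block d \<rho> a b = C a * adj (C b)"
    proof (rule eq_matI)
      fix i j assume "i < dim_row (C a * adj (C b))" "j < dim_col (C a * adj (C b))"
      then have ij: "i < d" "j < d" by (auto simp: C_def adj_def)
      have "ancilla_block d \<rho> a b $$ (i,j) = (\<Sum>k<d * d. B $$ (i * d + a, k) * adj B $$ (k, j * d + b))"
        unfolding \<rho> ancilla_block_def using ij ab Bc
        by (subst mult_mat_entry[of _ "d * d" "d * d" _ "d * d", symmetric]) (auto simp: product_index_less)
      also have "\<dots> = (\<Sum>k<d * d. C a $$ (i,k) * adj (C b) $$ (k,j))"
        using ij ab Bc by (intro sum.cong refl) (auto simp: C_def product_index_less)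
      also have "\<dots> = (C a * adj (C b)) $$ (i,j)"
        using Cc ij by (intro mult_mat_entry[symmetric]) auto
      finally show "ancilla_block d \<rho> a b $$ (i,j) = (C a * adj (C b)) $$ (i,j)" .
    qed (auto simp: ancilla_block_def C_def adj_def)
    have KC: "(K * C a) $$ (i,k) = (K * N k) $$ (i,a)" if "i < d" "a < d" "k < d * d" for i a k
    proof -
      have "(K * C a) $$ (i,k) = (\<Sum>l<d. K $$ (i,l) * C a $$ (l,k))"
        using K Cc that by (intro mult_mat_entry) auto
      also have "\<dots> = (\<Sum>l<d. K $$ (i,l) * N k $$ (l,a))"
        using that by (intro sum.cong refl) (auto simp: C_def N_def)
      also have "\<dots> = (K * N k) $$ (i,a)"
        using K Nc that by (intro mult_mat_entry[symmetric]) auto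
      finally show ?thesis .
    qed
    have KCc: "K * C a \<in> carrier_mat d (d * d)" for a using K Cc by (rule mult_carrier_mat)
    have "K * (C a * adj (C b)) * adj K = K * C a * adj (C b) * adj K"
      using K Cc by (subst assoc_mult_mat[of K d d "C a" "d * d" "adj (C b)" d]) auto
    also have "\<dots> = (K * C a) * (adj (C b) * adj K)"
      using KCc K Cc by (intro assoc_mult_mat[of _ d "d * d" _ d _ d]) auto
    also have "\<dots> = (K * C a) * adj (K * C b)" using adj_mult[OF K Cc] by simp
    finally have lhs: "K * ancilla_block d \<rho> a b * adj K = (K * C a) * adj (K * C b)"
      unfolding blk .
    show "K * ancilla_block d \<rho> a b * adj K
        = ancilla_block d (msum (d * d) {..<d * d} (\<lambda>k. vec_proj d (K * N k))) a b"
      unfolding lhs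
    proof (rule eq_matI)
      fix i j
      assume "i < dim_row (ancilla_block d (msum (d * d) {..<d * d} (\<lambda>k. vec_proj d (K * N k))) a b)"
        "j < dim_col (ancilla_block d (msum (d * d) {..<d * d} (\<lambda>k. vec_proj d (K * N k))) a b)"
      then have ij: "i < d" "j < d" by (auto simp: ancilla_block_def)
      have "((K * C a) * adj (K * C b)) $$ (i,j) = (\<Sum>k<d * d. (K * C a) $$ (i,k) * adj (K * C b) $$ (k,j))"
        using KCc ij by (intro mult_mat_entry) auto
      also have "\<dots> = (\<Sum>k<d * d. (K * N k) $$ (i,a) * cnj ((K * N k) $$ (j,b)))"
      proof (intro sum.cong refl)
        fix k assume "k \<in> {..<d * d}"
        then have k: "k < d * d" by simp
        have "adj (K * C b) $$ (k,j) = cnj ((K * C b) $$ (j,k))"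
          using KCc[of b] k ij by (intro adj_entry) auto
        then show "(K * C a) $$ (i,k) * adj (K * C b) $$ (k,j) = (K * N k) $$ (i,a) * cnj ((K * N k) $$ (j,b))"
          unfolding KC[OF ij(2) ab(2) k] KC[OF ij(1) ab(1) k] by simp
      qed
      also have "\<dots> = ancilla_block d (msum (d * d) {..<d * d} (\<lambda>k. vec_proj d (K * N k))) a b $$ (i,j)"
        using ij ab by (simp add: ancilla_block_def msum_def product_index_less del: index_mult_mat)
      finally show "((K * C a) * adj (K * C b)) $$ (i,j)
          = ancilla_block d (msum (d * d) {..<d * d} (\<lambda>k. vec_proj d (K * N k))) a b $$ (i,j)" .
    qed (use KCc K in \<open>auto simp: ancilla_block_def adj_def\<close>)
  qed
qed

section \<open>The ensemble produced by a classical memory\<close>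

lemma ext_id_ancilla_block:
  "ext_id d d E M = mat (d * d) (d * d) (\<lambda>(r,c). E (ancilla_block d M (r mod d) (c mod d)) $$ (r div d, c div d))"
  by (simp add: ext_id_def ancilla_block_def)

lemma ancilla_block_carrier [simp]: "ancilla_block d M a b \<in> carrier_mat d d"
  by (simp add: ancilla_block_def)

lemma ancilla_block_entry:
  "r < d * d \<Longrightarrow> c < d * d \<Longrightarrow> ancilla_block d M (r mod d) (c mod d) $$ (r div d, c div d) = M $$ (r,c)"
  by (simp add: ancilla_block_def product_index_split)

text \<open>One splitting of the transposed \<open>\<rho>2\<close> is bounded through the component
  purity gaps, whose sum is then compared with either marginal of \<open>\<rho>1\<close>. Splittings
  rather than norm bounds are returned because the transpose for \<open>T_S\<close> is still to be
  taken.\<close>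

lemma classical_memory_bound:
  assumes E1: "CPT d E1" and dens: "density (d * d) \<rho>0" and real: "realizable_classical d E1 E2"
  defines "\<rho>1 \<equiv> ext_id d d E1 \<rho>0" and "\<rho>2 \<equiv> ext_id d d E2 \<rho>0"
  shows "psd_split (d * d) (ptrans_A d \<rho>2)
      (1 + sqrt (real d * (real d - 1)) * sqrt (purity_gap (ptrace_A d \<rho>1)))"
    and "psd_split (d * d) (ptrans_A d \<rho>2)
      (1 + sqrt (real d * (real d - 1)) * sqrt (purity_gap (ptrace_S d \<rho>1)))"
    and "mtrace (ptrace_A d \<rho>1) = 1" and "mtrace (ptrace_S d \<rho>1) = 1"
proof -
  obtain I :: "nat set" and K \<Phi> where I: "finite I"
    and K: "\<And>i. i \<in> I \<Longrightarrow> K i \<in> carrier_mat d d" and \<Phi>: "\<And>i. i \<in> I \<Longrightarrow> CPT d (\<Phi> i)"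
    and E1K: "\<And>X. X \<in> carrier_mat d d \<Longrightarrow> E1 X = msum d I (\<lambda>i. K i * X * adj (K i))"
    and E2K: "\<And>X. X \<in> carrier_mat d d \<Longrightarrow> E2 X = msum d I (\<lambda>i. \<Phi> i (K i * X * adj (K i)))"
    using real unfolding realizable_classical_def by blast
  have \<rho>0: "psd (d * d) \<rho>0" "mtrace \<rho>0 = 1" using dens by (auto simp: density_def)
  obtain N :: "nat \<Rightarrow> complex mat" where N: "\<And>k. N k \<in> carrier_mat d d"
    and KN: "\<And>K a b. K \<in> carrier_mat d d \<Longrightarrow> a < d \<Longrightarrow> b < d \<Longrightarrow>
      K * ancilla_block d \<rho>0 a b * adj K
        = ancilla_block d (msum (d * d) {..<d * d} (\<lambda>k. vec_proj d (K * N k))) a b"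
    using psd_vec_proj_decomposition[OF \<rho>0(1)] by blast
  \<comment> \<open>An index \<open>p\<close> pairs a memory outcome with a pure component of
    \<open>\<rho>0\<close>.\<close>
  define M where "M p = K (fst p) * N (snd p)" for p
  define J where "J = I \<times> {..<d * d}"
  have J: "finite J" using I by (simp add: J_def)
  have M: "M p \<in> carrier_mat d d" if "p \<in> J" for p
    using that K N by (auto simp: M_def J_def)
  \<comment> \<open>\<open>H i\<close> is the unnormalised joint state after outcome
    \<open>i\<close>, to which only the channel \<open>\<Phi> i\<close> is applied later.\<close>
  define H where "H i = msum (d * d) {..<d * d} (\<lambda>k. vec_proj d (M (i,k)))" for i
  have KH: "K i * ancilla_block d \<rho>0 a b * adj (K i) = ancilla_block d (H i) a b"
    if "i \<in> I" "a < d" "b < d" for i a b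
    using KN[OF K] that by (simp add: H_def M_def)

  have \<rho>1: "\<rho>1 = msum (d * d) J (\<lambda>p. vec_proj d (M p))"
  proof (rule eq_matI)
    fix r c
    assume "r < dim_row (msum (d * d) J (\<lambda>p. vec_proj d (M p)))" "c < dim_col (msum (d * d) J (\<lambda>p. vec_proj d (M p)))"
    then have rc: "r < d * d" "c < d * d" by (auto simp: msum_def)
    note rc' = product_index_split[OF rc(1)] product_index_split[OF rc(2)]
    have "\<rho>1 $$ (r,c) = (\<Sum>i\<in>I. (K i * ancilla_block d \<rho>0 (r mod d) (c mod d) * adj (K i)) $$ (r div d, c div d))"
      using rc rc' by (simp add: \<rho>1_def ext_id_ancilla_block E1K msum_def del: index_mult_mat)
    also have "\<dots> = (\<Sum>i\<in>I. H i $$ (r,c))"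
      using rc rc' by (intro sum.cong refl) (simp add: KH ancilla_block_entry del: index_mult_mat)
    also have "\<dots> = (\<Sum>i\<in>I. \<Sum>k<d * d. vec_proj d (M (i,k)) $$ (r,c))"
      using rc by (simp add: H_def msum_def)
    also have "\<dots> = (\<Sum>p\<in>J. vec_proj d (M p) $$ (r,c))"
      by (simp add: J_def sum.cartesian_product split_def)
    finally show "\<rho>1 $$ (r,c) = msum (d * d) J (\<lambda>p. vec_proj d (M p)) $$ (r,c)"
      using rc by (simp add: msum_def)
  qed (auto simp: \<rho>1_def ext_id_def msum_def)

  have \<rho>2: "\<rho>2 = msum (d * d) I (\<lambda>i. ext_id d d (\<Phi> i) (H i))"
  proof (rule eq_matI)
    fix r c
    assume "r < dim_row (msum (d * d) I (\<lambda>i. ext_id d d (\<Phi> i) (H i)))"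
      "c < dim_col (msum (d * d) I (\<lambda>i. ext_id d d (\<Phi> i) (H i)))"
    then have rc: "r < d * d" "c < d * d" by (auto simp: msum_def)
    note rc' = product_index_split[OF rc(1)] product_index_split[OF rc(2)]
    have "\<rho>2 $$ (r,c) = (\<Sum>i\<in>I. \<Phi> i (K i * ancilla_block d \<rho>0 (r mod d) (c mod d) * adj (K i)) $$ (r div d, c div d))"
      using rc rc' by (simp add: \<rho>2_def ext_id_ancilla_block E2K msum_def)
    also have "\<dots> = (\<Sum>i\<in>I. ext_id d d (\<Phi> i) (H i) $$ (r,c))"
      using rc rc' by (intro sum.cong refl) (simp add: KH ext_id_ancilla_block)
    finally show "\<rho>2 $$ (r,c) = msum (d * d) I (\<lambda>i. ext_id d d (\<Phi> i) (H i)) $$ (r,c)"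
      using rc by (simp add: msum_def)
  qed (auto simp: \<rho>2_def ext_id_def msum_def)

  define G where "G p = M p * adj (M p)" for p
  define s where "s = sqrt (real d * (real d - 1))"
  have Gc: "G p \<in> carrier_mat d d" if "p \<in> J" for p using M[OF that] by (simp add: G_def)

  \<comment> \<open>The pure-state bounds are added over \<open>k\<close>, passed through
    \<open>\<Phi> i\<close> on S, and added over \<open>i\<close>.\<close>
  have "psd_split (d * d) (ptrans_A d \<rho>2) (\<Sum>i\<in>I. \<Sum>k<d * d. Re (mtrace (G (i,k))) + s * sqrt (purity_gap (G (i,k))))"
    unfolding \<rho>2 ptrans_A_msum ptrans_A_ext_id H_def
  proof (intro psd_split_msum psd_split_ext_id \<Phi> I finite_lessThan)
    fix i k assume "i \<in> I" "k \<in> {..<d * d}"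
    then have "M (i,k) \<in> carrier_mat d d" using M by (simp add: J_def)
    then show "psd_split (d * d) (ptrans_A d (vec_proj d (M (i,k)))) (Re (mtrace (G (i,k))) + s * sqrt (purity_gap (G (i,k))))"
      unfolding G_def s_def by (rule psd_split_ptrans_A_vec_proj)
  qed
  also have "(\<Sum>i\<in>I. \<Sum>k<d * d. Re (mtrace (G (i,k))) + s * sqrt (purity_gap (G (i,k))))
      = (\<Sum>p\<in>J. Re (mtrace (G p))) + s * (\<Sum>p\<in>J. sqrt (purity_gap (G p)))"
    unfolding J_def sum.cartesian_product
    by (simp add: sum.distrib sum_distrib_left split_def)
  finally have split: "psd_split (d * d) (ptrans_A d \<rho>2)
    ((\<Sum>p\<in>J. Re (mtrace (G p))) + s * (\<Sum>p\<in>J. sqrt (purity_gap (G p))))" .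

  have \<rho>S: "ptrace_A d \<rho>1 = msum d J G"
    unfolding \<rho>1 ptrace_A_msum G_def by (intro msum_cong ptrace_A_vec_proj M)
  have \<rho>A: "ptrace_S d \<rho>1 = msum d J (\<lambda>p. (adj (M p) * M p)\<^sup>T)"
    unfolding \<rho>1 ptrace_S_msum by (intro msum_cong ptrace_S_vec_proj M)
  have \<rho>1c: "\<rho>1 \<in> carrier_mat (d * d) (d * d)" unfolding \<rho>1 by simp
  have tr1: "mtrace \<rho>1 = 1"
    unfolding \<rho>1_def using mtrace_ext_id[OF E1 psd_carrier[OF \<rho>0(1)]] \<rho>0(2) by simp
  show trS: "mtrace (ptrace_A d \<rho>1) = 1" and trA: "mtrace (ptrace_S d \<rho>1) = 1"
    using mtrace_ptrace_A[OF \<rho>1c] mtrace_ptrace_S[OF \<rho>1c] tr1 by auto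
  \<comment> \<open>The component weights add up to the trace of \<open>\<rho>1\<close>, which
    supplies the constant 1 in the bounds.\<close>
  have sumtr: "(\<Sum>p\<in>J. Re (mtrace (G p))) = 1"
    using trS Gc unfolding \<rho>S by (simp add: mtrace_msum Re_sum[symmetric] del: Re_sum)
  \<comment> \<open>The case split is needed since \<open>real d - 1\<close> is negative at
    \<open>d = 0\<close>, where the product is zero.\<close>
  have s0: "0 \<le> s" unfolding s_def by (cases d) auto
  have psdS: "psd d (G p)" if "p \<in> J" for p
    unfolding G_def using M[OF that] by (rule psd_gram)
  have psdA: "psd d (adj (M p) * M p)" if "p \<in> J" for p
    using psd_gram[of "adj (M p)" d d] M[OF that] by simp
  have "(\<Sum>p\<in>J. sqrt (purity_gap (G p))) \<le> sqrt (purity_gap (ptrace_A d \<rho>1))"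
    unfolding \<rho>S using J psdS by (rule sqrt_purity_gap_msum)
  then show "psd_split (d * d) (ptrans_A d \<rho>2)
      (1 + sqrt (real d * (real d - 1)) * sqrt (purity_gap (ptrace_A d \<rho>1)))"
    using psd_split_mono[OF split] s0 sumtr by (simp add: s_def mult_left_mono)
  \<comment> \<open>Each component has equal purity gaps on S and A, so superadditivity can be run
    again over the ancilla marginals.\<close>
  have "(\<Sum>p\<in>J. sqrt (purity_gap (G p))) = (\<Sum>p\<in>J. sqrt (purity_gap (adj (M p) * M p)\<^sup>T))"
  proof (intro sum.cong refl)
    fix p assume p: "p \<in> J"
    show "sqrt (purity_gap (G p)) = sqrt (purity_gap (adj (M p) * M p)\<^sup>T)"
      using purity_gap_transpose[OF psd_carrier[OF psdA[OF p]]] purity_gap_adj_mult(2)[OF M[OF p]]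
      by (simp add: G_def)
  qed
  also have "\<dots> \<le> sqrt (purity_gap (ptrace_S d \<rho>1))"
    unfolding \<rho>A using J by (rule sqrt_purity_gap_msum) (intro psd_transpose psdA)
  finally show "psd_split (d * d) (ptrans_A d \<rho>2)
      (1 + sqrt (real d * (real d - 1)) * sqrt (purity_gap (ptrace_S d \<rho>1)))"
    using psd_split_mono[OF split] s0 sumtr by (simp add: s_def mult_left_mono)
qed

theorem theorem1:
  fixes d :: nat and E1 E2 :: "complex mat \<Rightarrow> complex mat" and \<rho>0 :: "complex mat"
  assumes "d \<ge> 2"
    and "CPT d E1" and "CPT d E2"
    and "density (d*d) \<rho>0"
    and "Delta d E1 E2 \<rho>0 > 0"
  shows "\<not> realizable_classical d E1 E2"
proof
  assume real: "realizable_classical d E1 E2"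
  define \<rho>1 where "\<rho>1 = ext_id d d E1 \<rho>0"
  define \<rho>2 where "\<rho>2 = ext_id d d E2 \<rho>0"
  define D where "D = real d * (real d - 1)"
  have D: "D > 0" using assms(1) by (simp add: D_def)
  note bound = classical_memory_bound[OF assms(2,4) real, folded \<rho>1_def \<rho>2_def D_def]
  \<comment> \<open>\<open>X\<close> stands for either marginal of \<open>\<rho>1\<close>, one for
    each root in the minimum.\<close>
  have key: "sqrt (2 / D) * max (trace_norm (ptrans_S d \<rho>2) - 1) (trace_norm (ptrans_A d \<rho>2) - 1)
      \<le> sqrt (2 * (1 - Re (mtrace (X * X))))"
    if X: "psd_split (d * d) (ptrans_A d \<rho>2) (1 + sqrt D * sqrt (purity_gap X))" "mtrace X = 1" for X
  proof -
    have "max (trace_norm (ptrans_S d \<rho>2) - 1) (trace_norm (ptrans_A d \<rho>2) - 1)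
        \<le> sqrt D * sqrt (purity_gap X)"
      using psd_split_trace_norm[OF X(1)] psd_split_trace_norm[OF psd_split_transpose[OF X(1)]]
      by (simp add: ptrans_S_eq_transpose)
    then have "sqrt (2 / D) * max (trace_norm (ptrans_S d \<rho>2) - 1) (trace_norm (ptrans_A d \<rho>2) - 1)
        \<le> sqrt (2 / D) * (sqrt D * sqrt (purity_gap X))"
      using D by (intro mult_left_mono) auto
    \<comment> \<open>The normalisation in \<open>F_Delta\<close> cancels the factor
      \<open>sqrt D\<close> from the count of off-diagonal pairs; unit trace then turns the gap into
      one minus the purity.\<close>
    also have "\<dots> = sqrt (2 * purity_gap X)"
      using D by (simp add: real_sqrt_mult[symmetric])
    finally show ?thesis using X(2) by (simp add: purity_gap_def)
  qed
  \<comment> \<open>Both roots dominate the scaled negativity term, hence so does their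
    minimum.\<close>
  have "0 \<le> F_Delta d E1 E2 \<rho>0"
    using key[OF bound(1,3)] key[OF bound(2,4)]
    unfolding F_Delta_def Let_def \<rho>1_def[symmetric] \<rho>2_def[symmetric] D_def by simp
  then show False using assms(5) by (simp add: Delta_def)
qed

end
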